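(* The $(3,12^2)$ lattice and the $(4,6,12)$ lattice are $(9,2)$-total-threshold-colorable.
   Context: An edge labeling of a graph $G=(V,E)$ is a map $l:E\to\{N,F\}$. A threshold-coloring of $G$ with respect to $l$ is a map $c:V\to\mathbb{Z}$ with an integer $t\ge0$ such that for every edge $(u,v)$, $|c(u)-c(v)|\le t$ iff $l(u,v)=N$; if $m,M$ are the minimum and maximum of $c$, any integer $r>M-m$ is a range, and $c$ is an $(r,t)$-threshold-coloring. $G$ is $(r,t)$-total-threshold-colorable if for every edge labeling there is an $(r,t)$-threshold-coloring with respect to it. An Archimedean lattice is the infinite graph of an edge-to-edge tiling of the plane by regular polygons in which all vertices have the same species (cyclic sequence of polygon sizes around the vertex), and it is named by that species: $(3,12^2)$ is the truncated hexagonal tiling (each vertex in one triangle and two regular 12-gons), $(4,6,12)$ is the truncated trihexagonal tiling (each vertex in a square, a hexagon and a 12-gon). Any induced subgraph of such a lattice is also referred to as the lattice, so the claim applies to all induced subgraphs. *)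

theory Defs
  imports "HOL-Analysis.Analysis"
begin

section \<open>Threshold-colorings\<close>

text \<open>A simple undirected graph is a vertex set with a set of two-element edges \<open>{u, v}\<close>.\<close>

type_synonym 'a graph = "'a set \<times> 'a set set"

definition induced_subgraph :: "'a graph \<Rightarrow> 'a set \<Rightarrow> 'a graph" where
  "induced_subgraph G W = (W, {e \<in> snd G. e \<subseteq> W})"

datatype edge_label = Near | Far

definition threshold_coloring ::
    "int \<Rightarrow> 'a graph \<Rightarrow> ('a set \<Rightarrow> edge_label) \<Rightarrow> ('a \<Rightarrow> int) \<Rightarrow> bool" where
  "threshold_coloring t G l c \<longleftrightarrow>
     t \<ge> 0 \<and> (\<forall>u v. {u, v} \<in> snd G \<longrightarrow> (\<bar>c u - c v\<bar> \<le> t \<longleftrightarrow> l {u, v} = Near))"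

text \<open>The graphs here may be infinite, so the existence of the minimum \<open>m\<close> and the maximum \<open>M\<close>
  of the coloring is part of the definition. The empty graph has neither, and every range is
  allowed for it.\<close>

definition has_range :: "'a graph \<Rightarrow> ('a \<Rightarrow> int) \<Rightarrow> int \<Rightarrow> bool" where
  "has_range G c r \<longleftrightarrow>
     fst G = {} \<or>
     (\<exists>m \<in> c ` fst G. \<exists>M \<in> c ` fst G. (\<forall>v \<in> fst G. m \<le> c v \<and> c v \<le> M) \<and> r > M - m)"

definition total_threshold_colorable :: "int \<Rightarrow> int \<Rightarrow> 'a graph \<Rightarrow> bool" where
  "total_threshold_colorable r t G \<longleftrightarrow>
     (\<forall>l. \<exists>c. threshold_coloring t G l c \<and> has_range G c r)"

section \<open>Tilings of the plane by regular polygons\<close>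

text \<open>A regular polygon is given by its number of sides, its center and one of its corners.
  Different choices of the corner can describe the same region, but two such descriptions never
  both occur in a tiling, because distinct tiles have disjoint interiors.\<close>

datatype rpolygon = RPolygon (num_sides: nat) (center: complex) (corner: complex)

definition nondegenerate :: "rpolygon \<Rightarrow> bool" where
  "nondegenerate P \<longleftrightarrow> num_sides P \<ge> 3 \<and> corner P \<noteq> center P"

definition vertex :: "rpolygon \<Rightarrow> nat \<Rightarrow> complex" where
  "vertex P k = center P + (corner P - center P) * cis (2 * pi * real k / real (num_sides P))"

definition vertices :: "rpolygon \<Rightarrow> complex set" where
  "vertices P = vertex P ` {..<num_sides P}"

definition region :: "rpolygon \<Rightarrow> complex set" where
  "region P = convex hull (vertices P)"

text \<open>A side is represented by the set of its two endpoints; the segment itself is the convex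
  hull of that set.\<close>

definition sides :: "rpolygon \<Rightarrow> complex set set" where
  "sides P = {{vertex P k, vertex P (Suc k)} | k. k < num_sides P}"

definition edge_to_edge_tiling :: "rpolygon set \<Rightarrow> bool" where
  "edge_to_edge_tiling T \<longleftrightarrow>
     (\<forall>P \<in> T. nondegenerate P) \<and>
     (\<Union>P \<in> T. region P) = UNIV \<and>
     (\<forall>P \<in> T. \<forall>Q \<in> T. P \<noteq> Q \<longrightarrow>
        interior (region P) \<inter> interior (region Q) = {} \<and>
        (region P \<inter> region Q = {} \<or>
         (\<exists>v \<in> vertices P \<inter> vertices Q. region P \<inter> region Q = {v}) \<or>
         (\<exists>e \<in> sides P \<inter> sides Q. region P \<inter> region Q = convex hull e)))"

definition tiling_vertices :: "rpolygon set \<Rightarrow> complex set" where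
  "tiling_vertices T = (\<Union>P \<in> T. vertices P)"

definition tiling_edges :: "rpolygon set \<Rightarrow> complex set set" where
  "tiling_edges T = (\<Union>P \<in> T. sides P)"

definition tiling_graph :: "rpolygon set \<Rightarrow> complex graph" where
  "tiling_graph T = (tiling_vertices T, tiling_edges T)"

text \<open>Going once around \<open>v\<close> one meets the tiles \<open>Ps\<close> at \<open>v\<close> and the edges \<open>es\<close> at \<open>v\<close>
  alternately, the edge \<open>es ! i\<close> separating the tile \<open>Ps ! i\<close> from its cyclic successor. The
  starting tile and the sense of rotation are not prescribed, so a species is a cyclic sequence up
  to reversal: the vertices of \<open>[4, 6, 12]\<close> occur in both orientations.\<close>

definition has_species :: "rpolygon set \<Rightarrow> complex \<Rightarrow> nat list \<Rightarrow> bool" where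
  "has_species T v s \<longleftrightarrow>
     (\<exists>Ps es. map num_sides Ps = s \<and> length es = length Ps \<and>
        distinct Ps \<and> set Ps = {P \<in> T. v \<in> vertices P} \<and>
        distinct es \<and> set es = {e \<in> tiling_edges T. v \<in> e} \<and>
        (\<forall>i < length Ps. es ! i \<in> sides (Ps ! i) \<inter> sides (Ps ! (Suc i mod length Ps))))"

definition archimedean_lattice :: "nat list \<Rightarrow> complex graph \<Rightarrow> bool" where
  "archimedean_lattice s G \<longleftrightarrow>
     (\<exists>T. edge_to_edge_tiling T \<and> (\<forall>v \<in> tiling_vertices T. has_species T v s) \<and>
        G = tiling_graph T)"

end

theory Submission
  imports Defs
begin

text \<open>
  Partition the vertices into the triangles of the first lattice and the squares of the second.
  Every vertex has exactly one edge leaving its tile. These outer edges point along three lines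
  only, within a connected component, and the outer edge of a vertex is parallel to the vector
  joining the centers of the two tiles it connects. Orienting all outer edges into a half plane
  therefore makes the graph of tiles acyclic. Colors are taken from \<open>{-4..4}\<close>, and the initial
  vertex of an outer edge is restricted to a palette that depends only on the line of the edge:
  \<open>{0}\<close>, \<open>{\<plusminus>1, \<dots>, \<plusminus>4}\<close>, \<open>{\<plusminus>2, \<plusminus>3}\<close> for triangles and \<open>{-1, 0}\<close>, \<open>{-3, 2}\<close>, \<open>{-4, -2, 1, 3}\<close> for
  squares. With these palettes a tile can be colored for every labeling and for all colors
  arriving along its incoming edges (a finite check), so every finite set of tiles can be colored
  in the order of the orientation, and a compactness argument handles the whole lattice. No global
  description of the tiling is needed: the directions are determined by the angles at each vertex.
\<close>

section \<open>Compactness and acyclic tile orders\<close>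

definition near :: "int \<Rightarrow> int \<Rightarrow> bool" where
  "near a b \<longleftrightarrow> \<bar>a - b\<bar> \<le> 2"

lemma near_commute: "near a b = near b a"
  by (simp add: near_def abs_minus_commute)

text \<open>Tychonoff: colorings with a finite palette form a compact product of discrete spaces,
  and a constraint on two coordinates is closed. Solvability of all finite subproblems is the finite
  intersection property.\<close>

lemma finite_palette_compactness:
  fixes V :: "'a set" and C :: "'b set"
  assumes "finite C" "C \<noteq> {}"
    and fin: "\<And>W. finite W \<Longrightarrow> W \<subseteq> V \<Longrightarrow>
      \<exists>c. (\<forall>v\<in>W. c v \<in> C) \<and> (\<forall>v\<in>W. \<forall>w\<in>W. R v w (c v) (c w))"
  shows "\<exists>c. (\<forall>v\<in>V. c v \<in> C) \<and> (\<forall>v\<in>V. \<forall>w\<in>V. R v w (c v) (c w))"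
proof -
  define X where "X = product_topology (\<lambda>_. discrete_topology C) V"
  have top: "topspace X = (\<Pi>\<^sub>E v\<in>V. C)"
    by (simp add: X_def)
  have "compact_space X"
    using \<open>finite C\<close>
    by (auto simp: X_def compact_space_product_topology compact_space_discrete_topology)
  define K where "K p = {c \<in> topspace X. R (fst p) (snd p) (c (fst p)) (c (snd p))}" for p
  have coord: "closedin X {c \<in> topspace X. c v \<in> {a}}" if "v \<in> V" "a \<in> C" for v a
    by (rule closedin_continuous_map_preimage[where Y = "discrete_topology C"])
      (use that in \<open>auto simp: X_def intro: continuous_map_product_projection\<close>)
  have closed: "closedin X (K p)" if "p \<in> V \<times> V" for p
  proof -
    obtain v w where p: "v \<in> V" "w \<in> V" "p = (v, w)"
      using \<open>p \<in> V \<times> V\<close> by (rule SigmaE)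
    \<comment> \<open>The constraint at \<open>(v, w)\<close> allows finitely many pairs of colors,
      so \<open>K p\<close> is a finite union of the closed cylinders \<open>L q\<close>.\<close>
    define I where "I = {q \<in> C \<times> C. R v w (fst q) (snd q)}"
    define L where "L q = {c \<in> topspace X. c v \<in> {fst q}} \<inter> {c \<in> topspace X. c w \<in> {snd q}}" for q
    have "I \<subseteq> C \<times> C"
      by (auto simp: I_def)
    then have "finite I"
      using \<open>finite C\<close> by (meson finite_SigmaI finite_subset)
    moreover have "closedin X (L q)" if "q \<in> I" for q
      unfolding L_def using \<open>I \<subseteq> C \<times> C\<close> that p(1,2)
      by (intro closedin_Int coord) auto
    ultimately have "closedin X (\<Union>(L ` I))"
      by (intro closedin_Union) auto
    moreover have "c \<in> K p \<longleftrightarrow> c \<in> \<Union>(L ` I)" for c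
    proof
      assume c: "c \<in> K p"
      show "c \<in> \<Union>(L ` I)"
      proof
        show "(c v, c w) \<in> I" "c \<in> L (c v, c w)"
          using c p PiE_mem[of c V "\<lambda>_. C"] by (simp_all add: K_def I_def L_def top)
      qed
    next
      assume "c \<in> \<Union>(L ` I)"
      then obtain q where "q \<in> I" "c \<in> L q"
        by blast
      then show "c \<in> K p"
        using p(3) by (simp add: K_def I_def L_def)
    qed
    ultimately show ?thesis
      by (metis subsetI subset_antisym)
  qed
  have "\<Inter>\<F> \<noteq> {}" if \<F>: "finite \<F>" "\<F> \<subseteq> K ` (V \<times> V)" for \<F>
  proof -
    obtain A where A: "A \<subseteq> V \<times> V" "finite A" "\<F> = K ` A"
      using finite_subset_image[OF \<F>] by metis
    define W where "W = fst ` A \<union> snd ` A"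
    have W: "finite W" "W \<subseteq> V"
      using A by (auto simp: W_def)
    obtain c where c: "\<And>v. v \<in> W \<Longrightarrow> c v \<in> C"
        "\<And>v w. v \<in> W \<Longrightarrow> w \<in> W \<Longrightarrow> R v w (c v) (c w)"
      using fin[OF W] by blast
    obtain a where "a \<in> C"
      using \<open>C \<noteq> {}\<close> by blast
    \<comment> \<open>Points of the product color all of \<open>V\<close>, so vertices outside
      \<open>W\<close> get an arbitrary default; the constraints in \<open>A\<close> do not see
      them.\<close>
    define d where "d = (\<lambda>v\<in>V. if v \<in> W then c v else a)"
    have "d \<in> K p" if "p \<in> A" for p
    proof -
      have "fst p \<in> W" "snd p \<in> W"
        using that by (auto simp: W_def)
      then show ?thesis
        using W c \<open>a \<in> C\<close> by (auto simp: K_def top d_def)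
    qed
    then have "d \<in> \<Inter>\<F>"
      using A(3) by simp
    then show ?thesis
      by auto
  qed
  then have "\<Inter>(K ` (V \<times> V)) \<noteq> {}"
    using \<open>compact_space X\<close>[unfolded compact_space_fip, rule_format, of "K ` (V \<times> V)"] closed
    by (metis (no_types, lifting) imageE)
  then obtain d where d: "\<And>p. p \<in> V \<times> V \<Longrightarrow> d \<in> K p"
    by blast
  show ?thesis
  proof (intro exI conjI ballI)
    fix v assume "v \<in> V"
    then show "d v \<in> C"
      using d[of "(v, v)"] by (auto simp: K_def top)
  next
    fix v w assume "v \<in> V" "w \<in> V"
    then show "R v w (d v) (d w)"
      using d[of "(v, w)"] by (auto simp: K_def)
  qed
qed

text \<open>Each vertex has at most one edge leaving its tile; it ends at \<open>mate v\<close>, and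
  \<open>out v\<close> says that it points away from \<open>v\<close>. In a finite set of tiles an
  \<open>r\<close>-maximal one is colored last: all edges between it and the rest then point into
  it, and the arriving colors lie in the palettes that \<open>step\<close> expects.\<close>

lemma tilewise_coloring:
  fixes V :: "'a set" and tile :: "'a \<Rightarrow> 'b" and pal :: "'a \<Rightarrow> int set"
  assumes C: "finite C"
    and r: "transp r" "asymp r"
    and N: "\<And>v w. N v w = N w v"
    and edge: "\<And>v w. {v, w} \<in> E \<Longrightarrow> v \<noteq> w \<and>
      (tile v = tile w \<or>
       mate v = w \<and> pal v = pal w \<and> out v \<noteq> out w \<and> (out v \<longrightarrow> r (tile v) (tile w)))"
    and pal: "\<And>v. v \<in> V \<Longrightarrow> pal v \<noteq> {} \<and> pal v \<subseteq> C"
    and step: "\<And>t x lab. t \<in> tile ` V \<Longrightarrow> (\<And>v. v \<in> V \<Longrightarrow> x v \<in> pal v) \<Longrightarrow>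
      \<exists>c. (\<forall>v\<in>V. tile v = t \<longrightarrow> c v \<in> C \<and> (out v \<longrightarrow> c v \<in> pal v) \<and>
             (\<not> out v \<longrightarrow> near (c v) (x v) = lab v)) \<and>
          (\<forall>v\<in>V. \<forall>w\<in>V. tile v = t \<longrightarrow> tile w = t \<longrightarrow> {v, w} \<in> E \<longrightarrow> near (c v) (c w) = N v w)"
  shows "\<exists>c. (\<forall>v\<in>V. c v \<in> C) \<and> (\<forall>v\<in>V. \<forall>w\<in>V. {v, w} \<in> E \<longrightarrow> near (c v) (c w) = N v w)"
proof (cases "V = {}")
  case False
  have tiles: "\<exists>c. (\<forall>v\<in>V. tile v \<in> \<T> \<longrightarrow> c v \<in> C \<and> (out v \<longrightarrow> c v \<in> pal v)) \<and>
      (\<forall>v\<in>V. \<forall>w\<in>V. tile v \<in> \<T> \<longrightarrow> tile w \<in> \<T> \<longrightarrow> {v, w} \<in> E \<longrightarrow> near (c v) (c w) = N v w)"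
    if "finite \<T>" "\<T> \<subseteq> tile ` V" for \<T>
    using that
  proof (induction \<T> rule: finite_psubset_induct)
    case (psubset \<T>)
    show ?case
    proof (cases "\<T> = {}")
      case False
      then obtain t where t: "t \<in> \<T>" "\<And>s. s \<in> \<T> \<Longrightarrow> \<not> r t s"
        using Finite_Set.bex_max_element[of \<T> r] psubset.hyps r
        by (metis asympD asymp_on_subset subset_UNIV transp_on_subset)
      define \<S> where "\<S> = \<T> - {t}"
      have "\<S> \<subset> \<T>" "\<S> \<subseteq> tile ` V"
        using t psubset.prems by (auto simp: \<S>_def)
      then obtain c where
        c1: "\<And>v. v \<in> V \<Longrightarrow> tile v \<in> \<S> \<Longrightarrow> c v \<in> C \<and> (out v \<longrightarrow> c v \<in> pal v)" and
        c2: "\<And>v w. v \<in> V \<Longrightarrow> w \<in> V \<Longrightarrow> tile v \<in> \<S> \<Longrightarrow> tile w \<in> \<S> \<Longrightarrow> {v, w} \<in> E \<Longrightarrow>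
          near (c v) (c w) = N v w"
        using psubset.IH[of \<S>] by blast
      \<comment> \<open>\<open>mate v\<close> may lie outside the tiles colored so far; any color of
        the palette then serves as a dummy, since no edge under consideration uses it.\<close>
      define x where "x v = (if c (mate v) \<in> pal v then c (mate v) else (SOME a. a \<in> pal v))" for v
      have x: "x v \<in> pal v" if "v \<in> V" for v
        using pal[OF that] some_in_eq[of "pal v"] by (simp add: x_def)
      have "t \<in> tile ` V"
        using t psubset.prems by blast
      then obtain d where
        d1: "\<And>v. v \<in> V \<Longrightarrow> tile v = t \<Longrightarrow> d v \<in> C \<and> (out v \<longrightarrow> d v \<in> pal v) \<and>
             (\<not> out v \<longrightarrow> near (d v) (x v) = N v (mate v))" and
        d2: "\<And>v w. v \<in> V \<Longrightarrow> w \<in> V \<Longrightarrow> tile v = t \<Longrightarrow> tile w = t \<Longrightarrow> {v, w} \<in> E \<Longrightarrow>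
             near (d v) (d w) = N v w"
        using step[of t x "\<lambda>v. N v (mate v)"] x by blast
      define e where "e v = (if tile v = t then d v else c v)" for v
      have cross: "near (d v) (c w) = N v w"
        if v: "v \<in> V" "tile v = t" and w: "w \<in> V" "tile w \<in> \<S>" and vw: "{v, w} \<in> E" for v w
      proof -
        have "tile v \<noteq> tile w" "\<not> r (tile v) (tile w)"
          using v w t by (auto simp: \<S>_def)
        \<comment> \<open>Were the edge outgoing at \<open>v\<close>, it would give
          \<open>r t (tile w)\<close>, against the maximality of \<open>t\<close>. So it is outgoing
          at \<open>w\<close>, and \<open>c w\<close> lies in the common palette.\<close>
        then have "mate v = w" "pal v = pal w" "\<not> out v" "out w"
          using edge[OF vw] by auto
        moreover from this have "x v = c w"
          using c1[OF w] by (simp add: x_def)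
        ultimately show ?thesis
          using d1[OF v] by simp
      qed
      show ?thesis
      proof (intro exI[of _ e] conjI ballI impI)
        fix v assume "v \<in> V" "tile v \<in> \<T>"
        then show "e v \<in> C" "out v \<Longrightarrow> e v \<in> pal v"
          using c1[of v] d1[of v] by (auto simp: e_def \<S>_def)
      next
        fix v w assume *: "v \<in> V" "w \<in> V" "tile v \<in> \<T>" "tile w \<in> \<T>" "{v, w} \<in> E"
        then have "{w, v} \<in> E"
          by (simp add: insert_commute)
        with * show "near (e v) (e w) = N v w"
          using c2[of v w] d2[of v w] cross[of v w] cross[of w v] N[of v w]
            near_commute[of "c v" "d w"]
          by (auto simp: e_def \<S>_def)
      qed
    qed simp
  qed
  have fin: "\<exists>c. (\<forall>v\<in>W. c v \<in> C) \<and> (\<forall>v\<in>W. \<forall>w\<in>W. {v, w} \<in> E \<longrightarrow> near (c v) (c w) = N v w)"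
    if "finite W" "W \<subseteq> V" for W
  proof -
    have W: "finite (tile ` W)" "tile ` W \<subseteq> tile ` V"
      using that by auto
    obtain c where
      c1: "\<And>v. v \<in> V \<Longrightarrow> tile v \<in> tile ` W \<Longrightarrow> c v \<in> C" and
      c2: "\<And>v w. v \<in> V \<Longrightarrow> w \<in> V \<Longrightarrow> tile v \<in> tile ` W \<Longrightarrow> tile w \<in> tile ` W \<Longrightarrow> {v, w} \<in> E \<Longrightarrow>
        near (c v) (c w) = N v w"
      using tiles[OF W] by metis
    show ?thesis
    proof (intro exI[of _ c] conjI ballI impI)
      show "c v \<in> C" if "v \<in> W" for v
        using c1 that \<open>W \<subseteq> V\<close> by (simp add: subsetD)
      show "near (c v) (c w) = N v w" if "v \<in> W" "w \<in> W" "{v, w} \<in> E" for v w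
        using c2 that \<open>W \<subseteq> V\<close> by (simp add: subsetD)
    qed
  qed
  have "C \<noteq> {}"
    using False pal by fastforce
  then show ?thesis
    using finite_palette_compactness[OF C, of V "\<lambda>v w a b. {v, w} \<in> E \<longrightarrow> near a b = N v w"] fin
    by simp
qed auto

section \<open>Palettes\<close>

text \<open>Nested uses filter a palette by several colored neighbors in turn, which turns the
  lemmas on tiles below into finite checks by evaluation.\<close>

definition choices :: "int \<Rightarrow> bool \<Rightarrow> int set \<Rightarrow> int set" where
  "choices x l A = {a \<in> A. near a x = l}"

text \<open>The palettes below were found by a computer search.\<close>

definition triangle_palette :: "nat \<Rightarrow> int set" where
  "triangle_palette k =
    (if k = 0 then {0} else if k = 1 then {-4, -3, -2, -1, 1, 2, 3, 4} else {-3, -2, 2, 3})"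

definition square_palette :: "nat \<Rightarrow> int set" where
  "square_palette k = (if k = 0 then {-1, 0} else if k = 1 then {-3, 2} else {-4, -2, 1, 3})"

lemma triangle_palette: "triangle_palette k \<noteq> {}" "triangle_palette k \<subseteq> {-4..4}"
  by (simp_all add: triangle_palette_def)

lemma square_palette: "square_palette k \<noteq> {}" "square_palette k \<subseteq> {-4..4}"
  by (simp_all add: square_palette_def)

text \<open>First orientation of a triangle: the corner of class 1 receives \<open>x\<close>, and
  the corners of classes 0 and 2 get the outgoing colors \<open>a\<close> and
  \<open>b\<close>.\<close>

lemma triangle_one_in:
  "\<forall>x\<in>triangle_palette 1. \<forall>l la lb l'.
    \<exists>a\<in>triangle_palette 0. \<exists>b\<in>choices a l' (triangle_palette 2).
      choices a la (choices b lb (choices x l {-4..4})) \<noteq> {}"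
  unfolding near_def choices_def triangle_palette_def by code_simp

text \<open>The reverse orientation: classes 0 and 2 receive \<open>x\<close> and \<open>y\<close>,
  class 1 is outgoing. No other orientation occurs, because the three outer directions sum to zero
  and the one of differing sign has class 1.\<close>

lemma triangle_two_in:
  "\<forall>x\<in>triangle_palette 0. \<forall>y\<in>triangle_palette 2. \<forall>lx ly la lb l'.
    \<exists>a\<in>choices x lx {-4..4}. \<exists>b\<in>choices a l' (choices y ly {-4..4}).
      choices a la (choices b lb (triangle_palette 1)) \<noteq> {}"
  unfolding near_def choices_def triangle_palette_def by code_simp

text \<open>Around the square, \<open>a\<close> and \<open>b\<close> color the two incoming corners,
  \<open>c\<close> and \<open>d\<close> the corners opposite to them, whose outer edges lie on the
  same lines \<open>i\<close> and \<open>j\<close>. Either line may come first, hence the ordered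
  pairs.\<close>

lemma square_two_in:
  "\<forall>i\<in>{0, 1, 2}. \<forall>j\<in>{0, 1, 2}. i \<noteq> j \<longrightarrow>
    (\<forall>x\<in>square_palette i. \<forall>y\<in>square_palette j. \<forall>lx ly lab lbc lcd lda.
     \<exists>a\<in>choices x lx {-4..4}. \<exists>b\<in>choices a lab (choices y ly {-4..4}).
     \<exists>c\<in>choices b lbc (square_palette i). choices a lda (choices c lcd (square_palette j)) \<noteq> {})"
  unfolding near_def choices_def square_palette_def by code_simp
section \<open>Directions of the outer edges\<close>

text \<open>Half of the punctured plane, closed under addition and containing exactly one of
  \<open>d\<close> and \<open>- d\<close> for \<open>d \<noteq> 0\<close>. Positivity of differences
  is thus a strict order on the plane.\<close>

definition positive_dir :: "complex \<Rightarrow> bool" where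
  "positive_dir d \<longleftrightarrow> Im d > 0 \<or> Im d = 0 \<and> Re d > 0"

lemma positive_dir_0 [simp]: "\<not> positive_dir 0"
  by (simp add: positive_dir_def)

lemma positive_dir_add: "positive_dir x \<Longrightarrow> positive_dir y \<Longrightarrow> positive_dir (x + y)"
  by (auto simp: positive_dir_def)

lemma positive_dir_uminus: "x \<noteq> 0 \<Longrightarrow> positive_dir (- x) \<longleftrightarrow> \<not> positive_dir x"
  by (auto simp: positive_dir_def complex_eq_iff)

lemma positive_dir_scale: "k > 0 \<Longrightarrow> positive_dir (of_real k * d) \<longleftrightarrow> positive_dir d"
  by (auto simp: positive_dir_def zero_less_mult_iff)

abbreviation zeta6 :: complex where
  "zeta6 \<equiv> cis (pi / 3)"

lemma zeta6_eq: "zeta6 = Complex (1 / 2) (sqrt 3 / 2)"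
  by (simp add: complex_eq_iff cos_60 sin_60)

lemma zeta6_times_zeta6: "zeta6 * zeta6 = zeta6 - 1"
  by (simp add: zeta6_eq complex_eq_iff)

lemma cnj_zeta6: "cnj zeta6 = 1 - zeta6"
  by (simp add: zeta6_eq complex_eq_iff)

text \<open>For \<open>d\<close> among the six directions \<open>\<plusminus>d\<^sub>0\<close>, \<open>\<plusminus>zeta6 * d\<^sub>0\<close>, \<open>\<plusminus>zeta6\<^sup>2 * d\<^sub>0\<close>, the class of \<open>d\<close> is the position of the
  line of \<open>d\<close> in the angular order of the three lines: class 1 is the middle one, whose positive
  direction has a positive neighbour on either side.\<close>

definition line_class :: "complex \<Rightarrow> nat" where
  "line_class d =
    (if positive_dir (zeta6 * d) \<noteq> positive_dir d then 0
     else if positive_dir (d - zeta6 * d) \<noteq> positive_dir d then 2 else 1)"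

lemma line_class_range: "line_class d \<in> {0, 1, 2}"
  by (simp add: line_class_def)

lemma zeta6_mult: "d \<noteq> 0 \<Longrightarrow> zeta6 * d \<noteq> 0" "d \<noteq> 0 \<Longrightarrow> d - zeta6 * d \<noteq> 0"
    "zeta6 * (zeta6 * d) = zeta6 * d - d"
proof -
  show "zeta6 * (zeta6 * d) = zeta6 * d - d"
    by (metis mult.assoc zeta6_times_zeta6 left_diff_distrib mult_1)
  assume "d \<noteq> 0"
  moreover have "zeta6 \<noteq> 1"
    by (simp add: zeta6_eq complex_eq_iff)
  ultimately show "zeta6 * d \<noteq> 0" "d - zeta6 * d \<noteq> 0"
    by auto
qed

lemma line_class_uminus: "d \<noteq> 0 \<Longrightarrow> line_class (- d) = line_class d"
  using positive_dir_uminus[of d] positive_dir_uminus[of "zeta6 * d"]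
    positive_dir_uminus[of "d - zeta6 * d"] zeta6_mult[of d]
  by (simp add: line_class_def)

text \<open>The tests in \<open>line_class\<close> probe the directions 60 degrees to the left and
  to the right of \<open>d\<close>, since \<open>d - zeta6 * d\<close> is
  \<open>cnj zeta6 * d\<close>.\<close>

lemma line_class_zeta6:
  assumes "d \<noteq> 0"
  shows "line_class (zeta6 * d) \<noteq> line_class d"
proof -
  \<comment> \<open>The tests never both find a change of sign: if \<open>d\<close> and
    \<open>- (zeta6 * d)\<close> have the same sign, so does their sum.\<close>
  have "positive_dir (d - zeta6 * d) = positive_dir d"
    if "positive_dir (zeta6 * d) \<noteq> positive_dir d"
    using that positive_dir_add[of d "- (zeta6 * d)"] positive_dir_add[of "- d" "zeta6 * d"]
      positive_dir_uminus[of d] positive_dir_uminus[of "zeta6 * d"] assms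
      positive_dir_uminus[of "d - zeta6 * d"] zeta6_mult[of d]
    by auto
  then show ?thesis
    using positive_dir_uminus[of "d - zeta6 * d"] zeta6_mult[of d] assms
    by (auto simp: line_class_def)
qed

text \<open>The three directions are 120 degrees apart. The negatives of the last two enclose
  \<open>d\<close> at 60 degrees on either side; they share the sign of \<open>d\<close>, which puts
  \<open>d\<close> on the middle line.\<close>

lemma line_class_triangle:
  assumes "d \<noteq> 0"
    and "positive_dir (zeta6 * d - d) = p" "positive_dir (- (zeta6 * d)) = p"
    and "positive_dir d \<noteq> p"
  shows "line_class d = 1" "line_class (zeta6 * d - d) = 2" "line_class (- (zeta6 * d)) = 0"
proof -
  note facts = positive_dir_uminus[of "d - zeta6 * d"] positive_dir_uminus[of "zeta6 * d"]
    positive_dir_uminus[of d] zeta6_mult[of d] assms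
  show "line_class d = 1"
    using facts by (auto simp: line_class_def)
  have "line_class (zeta6 * d) = 0"
    using facts by (auto simp: line_class_def)
  then show "line_class (- (zeta6 * d)) = 0"
    using line_class_uminus[of "zeta6 * d"] facts by auto
  have "zeta6 * (zeta6 * d - d) = - d"
    by (simp add: right_diff_distrib zeta6_mult(3))
  then show "line_class (zeta6 * d - d) = 2"
    using facts by (auto simp: line_class_def)
qed

text \<open>Instance of \<open>tilewise_coloring\<close> with tiles ordered by positivity of the
  difference of their centers. As this difference is a positive multiple of \<open>D v\<close>, an
  outer edge with positive \<open>D v\<close> leads upwards in the order. Its ends have opposite
  \<open>D\<close>, hence the same line and palette.\<close>

lemma direction_coloring:
  fixes V :: "complex set" and tile :: "complex \<Rightarrow> 'b"
  assumes N: "\<And>v w. N v w = N w v"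
    and D: "\<And>v. v \<in> V \<Longrightarrow> D v \<noteq> 0"
    and edge: "\<And>v w. {v, w} \<in> E \<Longrightarrow> v \<in> V \<and> v \<noteq> w \<and>
      (tile v = tile w \<or> w = v + D v \<and> D w = - D v \<and>
        (\<exists>k>0. ctr (tile w) - ctr (tile v) = of_real k * D v))"
    and pal: "\<And>k. k \<in> {0, 1, 2} \<Longrightarrow> pal k \<noteq> {} \<and> pal k \<subseteq> {-4..4}"
    and step: "\<And>t x lab. t \<in> tile ` V \<Longrightarrow> (\<And>v. v \<in> V \<Longrightarrow> x v \<in> pal (line_class (D v))) \<Longrightarrow>
      \<exists>c. (\<forall>v\<in>V. tile v = t \<longrightarrow> c v \<in> {-4..4} \<and>
             (positive_dir (D v) \<longrightarrow> c v \<in> pal (line_class (D v))) \<and>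
             (\<not> positive_dir (D v) \<longrightarrow> near (c v) (x v) = lab v)) \<and>
          (\<forall>v\<in>V. \<forall>w\<in>V. tile v = t \<longrightarrow> tile w = t \<longrightarrow> {v, w} \<in> E \<longrightarrow> near (c v) (c w) = N v w)"
  shows "\<exists>c. (\<forall>v\<in>V. c v \<in> {-4..4}) \<and>
    (\<forall>v\<in>V. \<forall>w\<in>V. {v, w} \<in> E \<longrightarrow> near (c v) (c w) = N v w)"
proof (rule tilewise_coloring[where tile = tile and mate = "\<lambda>v. v + D v"
      and out = "\<lambda>v. positive_dir (D v)" and pal = "\<lambda>v. pal (line_class (D v))"
      and r = "\<lambda>s t. positive_dir (ctr t - ctr s)"])
  show "transp (\<lambda>s t. positive_dir (ctr t - ctr s))"
  proof (rule transpI)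
    fix s t u
    assume "positive_dir (ctr t - ctr s)" "positive_dir (ctr u - ctr t)"
    then show "positive_dir (ctr u - ctr s)"
      using positive_dir_add by fastforce
  qed
  show "asymp (\<lambda>s t. positive_dir (ctr t - ctr s))"
  proof (rule asympI)
    fix s t
    assume "positive_dir (ctr t - ctr s)"
    then show "\<not> positive_dir (ctr s - ctr t)"
      by (metis minus_diff_eq positive_dir_0 positive_dir_uminus)
  qed
  fix v w assume vw: "{v, w} \<in> E"
  show "v \<noteq> w \<and> (tile v = tile w \<or> v + D v = w \<and>
      pal (line_class (D v)) = pal (line_class (D w)) \<and>
      positive_dir (D v) \<noteq> positive_dir (D w) \<and>
      (positive_dir (D v) \<longrightarrow> positive_dir (ctr (tile w) - ctr (tile v))))"
    using edge[OF vw] D[of v] positive_dir_uminus[of "D v"] line_class_uminus[of "D v"]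
      positive_dir_scale by auto
next
  fix v show "pal (line_class (D v)) \<noteq> {} \<and> pal (line_class (D v)) \<subseteq> {-4..4}"
    using pal line_class_range by blast
qed (use N step in \<open>simp_all\<close>)

section \<open>Coloring a single tile for all arriving colors\<close>

text \<open>\<open>u\<close> is the corner whose orientation differs from that of the other two. Its
  class is then 1, so the two finite checks for triangles cover both orientations.\<close>

lemma triangle_step:
  fixes D :: "'a \<Rightarrow> complex"
  assumes N: "\<And>v w. N v w = N w v"
    and D: "D u \<noteq> 0" "D v = zeta6 * D u - D u" "D w = - (zeta6 * D u)"
    and out: "positive_dir (D v) = positive_dir (D w)" "positive_dir (D u) \<noteq> positive_dir (D w)"
    and distinct: "distinct [u, v, w]"
    and x: "\<And>y. y \<in> {u, v, w} \<Longrightarrow> x y \<in> triangle_palette (line_class (D y))"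
  shows "\<exists>c. (\<forall>y\<in>{u, v, w}. c y \<in> {-4..4} \<and>
      (positive_dir (D y) \<longrightarrow> c y \<in> triangle_palette (line_class (D y))) \<and>
      (\<not> positive_dir (D y) \<longrightarrow> near (c y) (x y) = lab y)) \<and>
    (\<forall>y\<in>{u, v, w}. \<forall>z\<in>{u, v, w}. y \<noteq> z \<longrightarrow> near (c y) (c z) = N y z)"
proof -
  have cls: "line_class (D u) = 1" "line_class (D v) = 2" "line_class (D w) = 0"
    using line_class_triangle[of "D u" "positive_dir (D w)", folded D(2,3), OF D(1) out(1) refl out(2)]
    by blast+
  have x': "x u \<in> triangle_palette 1" "x v \<in> triangle_palette 2" "x w \<in> triangle_palette 0"
    using x[of u] x[of v] x[of w] by (simp_all add: cls)
  have "\<exists>cu cv cw. near cu cv = N u v \<and> near cu cw = N u w \<and> near cv cw = N v w \<and>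
      cu \<in> {-4..4} \<and> cv \<in> {-4..4} \<and> cw \<in> {-4..4} \<and>
      (if positive_dir (D u)
       then cu \<in> triangle_palette 1 \<and> near cv (x v) = lab v \<and> near cw (x w) = lab w
       else cv \<in> triangle_palette 2 \<and> cw \<in> triangle_palette 0 \<and> near cu (x u) = lab u)"
  proof (cases "positive_dir (D u)")
    case True
    \<comment> \<open>\<open>a\<close>, \<open>b\<close>, \<open>c\<close> color \<open>w\<close>,
      \<open>v\<close>, \<open>u\<close>, the corners of classes 0, 2 and 1.\<close>
    from triangle_two_in[rule_format, OF x'(3,2), of "lab w" "N v w" "lab v" "N u w" "N u v"]
    obtain a b c where "a \<in> choices (x w) (lab w) {-4..4}"
      "b \<in> choices a (N v w) (choices (x v) (lab v) {-4..4})"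
      "c \<in> choices a (N u w) (choices b (N u v) (triangle_palette 1))"
      by (metis ex_in_conv)
    then have "near c b = N u v" "near c a = N u w" "near b a = N v w" "a \<in> {-4..4}" "b \<in> {-4..4}"
      "near b (x v) = lab v" "near a (x w) = lab w" "c \<in> triangle_palette 1"
      unfolding choices_def by blast+
    with True triangle_palette(2)[THEN subsetD, of c 1] show ?thesis
      by (intro exI[of _ c] exI[of _ b] exI[of _ a]) (simp del: atLeastAtMost_iff)
  next
    case False
    from triangle_one_in[rule_format, OF x'(1), of "N v w" "N u w" "N u v" "lab u"]
    obtain a b c where "a \<in> triangle_palette 0" "b \<in> choices a (N v w) (triangle_palette 2)"
      "c \<in> choices a (N u w) (choices b (N u v) (choices (x u) (lab u) {-4..4}))"
      by (metis ex_in_conv)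
    then have "near c b = N u v" "near c a = N u w" "near b a = N v w" "c \<in> {-4..4}"
      "near c (x u) = lab u" "b \<in> triangle_palette 2" "a \<in> triangle_palette 0"
      unfolding choices_def by blast+
    with False triangle_palette(2)[THEN subsetD, of a 0] triangle_palette(2)[THEN subsetD, of b 2]
    show ?thesis
      by (intro exI[of _ c] exI[of _ b] exI[of _ a]) (simp del: atLeastAtMost_iff)
  qed
  then obtain cu cv cw where c: "near cu cv = N u v" "near cu cw = N u w" "near cv cw = N v w"
      "cu \<in> {-4..4}" "cv \<in> {-4..4}" "cw \<in> {-4..4}"
      "if positive_dir (D u)
       then cu \<in> triangle_palette 1 \<and> near cv (x v) = lab v \<and> near cw (x w) = lab w
       else cv \<in> triangle_palette 2 \<and> cw \<in> triangle_palette 0 \<and> near cu (x u) = lab u"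
    by blast
  define c where "c y = (if y = u then cu else if y = v then cv else cw)" for y
  have c': "c u = cu" "c v = cv" "c w = cw"
    using distinct by (auto simp: c_def)
  show ?thesis
  proof (intro exI[of _ c] conjI ballI impI)
    fix y assume y: "y \<in> {u, v, w}"
    show "c y \<in> {-4..4}"
      using y c c' by (elim insertE) (simp_all del: atLeastAtMost_iff)
    show "c y \<in> triangle_palette (line_class (D y))" if "positive_dir (D y)"
      using y that c(7) c' out by (elim insertE) (simp_all add: cls)
    show "near (c y) (x y) = lab y" if "\<not> positive_dir (D y)"
      using y that c(7) c' out by (elim insertE) (simp_all split: if_splits)
  next
    fix y z assume "y \<in> {u, v, w}" "z \<in> {u, v, w}" "y \<noteq> z"
    then show "near (c y) (c z) = N y z"
      using c(1-3) c' N near_commute by (elim insertE) simp_all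
  qed
qed

text \<open>Opposite corners have opposite outer directions, so exactly one of them is incoming and
  both use the same palette. Starting the numbering at the two incoming corners leaves a single
  finite check.\<close>

lemma square_step:
  fixes D :: "'a \<Rightarrow> complex"
  assumes N: "\<And>v w. N v w = N w v"
    and D: "D v0 \<noteq> 0" "D v1 \<noteq> 0" "D v2 = - D v0" "D v3 = - D v1"
      "line_class (D v0) \<noteq> line_class (D v1)"
    and out: "\<not> positive_dir (D v0)" "\<not> positive_dir (D v1)"
    and distinct: "distinct [v0, v1, v2, v3]"
    and x: "\<And>y. y \<in> {v0, v1, v2, v3} \<Longrightarrow> x y \<in> square_palette (line_class (D y))"
  shows "\<exists>c. (\<forall>y\<in>{v0, v1, v2, v3}. c y \<in> {-4..4} \<and>
      (positive_dir (D y) \<longrightarrow> c y \<in> square_palette (line_class (D y))) \<and>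
      (\<not> positive_dir (D y) \<longrightarrow> near (c y) (x y) = lab y)) \<and>
    (\<forall>y z. {y, z} \<in> {{v0, v1}, {v1, v2}, {v2, v3}, {v3, v0}} \<longrightarrow> near (c y) (c z) = N y z)"
proof -
  let ?A = "square_palette (line_class (D v0))" and ?B = "square_palette (line_class (D v1))"
  have cls: "line_class (D v2) = line_class (D v0)" "line_class (D v3) = line_class (D v1)"
    using D by (simp_all add: line_class_uminus)
  have x': "x v0 \<in> ?A" "x v1 \<in> ?B"
    using x by auto
  from square_two_in[rule_format, OF line_class_range line_class_range D(5) x',
      of "lab v0" "N v1 v0" "lab v1" "N v2 v1" "N v3 v0" "N v3 v2"]
  obtain a b c' d where *: "a \<in> choices (x v0) (lab v0) {-4..4}"
    "b \<in> choices a (N v1 v0) (choices (x v1) (lab v1) {-4..4})"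
    "c' \<in> choices b (N v2 v1) ?A"
    "d \<in> choices a (N v3 v0) (choices c' (N v3 v2) ?B)"
    by (metis ex_in_conv)
  then have *: "near b a = N v1 v0" "near c' b = N v2 v1" "near d c' = N v3 v2" "near d a = N v3 v0"
    "near a (x v0) = lab v0" "near b (x v1) = lab v1"
    and **: "a \<in> {-4..4}" "b \<in> {-4..4}" "c' \<in> ?A" "d \<in> ?B"
    unfolding choices_def by blast+
  from ** have range: "c' \<in> {-4..4}" "d \<in> {-4..4}"
    using square_palette(2) by blast+
  define c where "c y = (if y = v0 then a else if y = v1 then b else if y = v2 then c' else d)" for y
  have c: "c v0 = a" "c v1 = b" "c v2 = c'" "c v3 = d"
    using distinct by (auto simp: c_def)
  have out': "positive_dir (D v2)" "positive_dir (D v3)"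
    using D out by (simp_all add: positive_dir_uminus)
  show ?thesis
  proof (intro exI[of _ c] conjI ballI impI allI)
    fix y assume y: "y \<in> {v0, v1, v2, v3}"
    show "c y \<in> {-4..4}"
      using y c ** range by (elim insertE) (simp_all del: atLeastAtMost_iff)
    show "c y \<in> square_palette (line_class (D y))" if "positive_dir (D y)"
      using y that c ** out by (elim insertE) (simp_all add: cls)
    show "near (c y) (x y) = lab y" if "\<not> positive_dir (D y)"
      using y that c * out' by (elim insertE) simp_all
  next
    fix y z assume "{y, z} \<in> {{v0, v1}, {v1, v2}, {v2, v3}, {v3, v0}}"
    then have "(y, z) \<in> {(v0, v1), (v1, v0), (v1, v2), (v2, v1), (v2, v3), (v3, v2), (v3, v0), (v0, v3)}"
      by (simp add: doubleton_eq_iff)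
    then show "near (c y) (c z) = N y z"
      using * c N near_commute by (elim insertE) simp_all
  qed
qed
section \<open>Vertex figures\<close>

abbreviation root_of :: "rpolygon \<Rightarrow> complex" where
  "root_of P \<equiv> cis (2 * pi / real (num_sides P))"

text \<open>Vector from the corner \<open>v\<close> to its counterclockwise neighbor;
  \<open>prv\<close> leads to the clockwise one. Both come from rotating about the center, so no
  index of the corner is needed.\<close>

definition nxt :: "rpolygon \<Rightarrow> complex \<Rightarrow> complex" where
  "nxt P v = (v - center P) * (root_of P - 1)"

definition prv :: "rpolygon \<Rightarrow> complex \<Rightarrow> complex" where
  "prv P v = (v - center P) * (cnj (root_of P) - 1)"

text \<open>Multiplication by \<open>turn n\<close> rotates by the interior angle \<open>pi - 2 * pi / n\<close> of the \<open>n\<close>-gon.\<close>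

definition turn :: "nat \<Rightarrow> complex" where
  "turn n = - cnj (cis (2 * pi / real n))"

lemma root_cnj: "root_of P * cnj (root_of P) = 1" "cnj (root_of P) * root_of P = 1"
  by (simp_all add: complex_norm_square[symmetric] mult.commute)

lemma turn_cnj: "turn n * cnj (turn n) = 1"
  by (simp add: turn_def complex_norm_square[symmetric] mult.commute)

lemma prv_eq_turn: "prv P v = nxt P v * turn (num_sides P)"
proof -
  have "(root_of P - 1) * turn (num_sides P) = cnj (root_of P) - root_of P * cnj (root_of P)"
    by (simp add: turn_def algebra_simps)
  then show ?thesis
    by (simp add: nxt_def prv_def root_cnj mult.assoc)
qed

lemma prv_after_nxt: "prv P (v + nxt P v) = - nxt P v"
  and nxt_after_prv: "nxt P (v + prv P v) = - prv P v"
proof -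
  have "v + nxt P v - center P = (v - center P) * root_of P"
    "v + prv P v - center P = (v - center P) * cnj (root_of P)"
    by (simp_all add: nxt_def prv_def algebra_simps)
  then show "prv P (v + nxt P v) = - nxt P v" "nxt P (v + prv P v) = - prv P v"
    by (simp_all only: nxt_def[of P "v + prv P v"] prv_def[of P "v + nxt P v"])
      (simp_all add: nxt_def prv_def right_diff_distrib mult.assoc root_cnj)
qed

text \<open>The root and its conjugate have a real sum, so the two side vectors add up to a real
  multiple of the radius vector. This recovers the center from the edges at a corner.\<close>

lemma nxt_add_prv: "nxt P v + prv P v = of_real (2 * Re (root_of P) - 2) * (v - center P)"
  by (simp add: nxt_def prv_def complex_eq_iff algebra_simps)

lemma vertex_power: "vertex P k = center P + (corner P - center P) * root_of P ^ k"
  by (simp add: vertex_def Complex.DeMoivre mult_ac)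

lemma vertex_Suc: "vertex P (Suc k) = vertex P k + nxt P (vertex P k)"
  by (simp add: vertex_power nxt_def algebra_simps)

lemma vertex_prv: "vertex P k = vertex P (Suc k) + prv P (vertex P (Suc k))"
  by (simp add: vertex_Suc prv_after_nxt)

lemma vertex_mod:
  assumes "nondegenerate P"
  shows "vertex P (k mod num_sides P) = vertex P k"
proof -
  have "root_of P ^ num_sides P = 1"
    using assms by (simp add: Complex.DeMoivre nondegenerate_def)
  then have "root_of P ^ (num_sides P * (k div num_sides P) + k mod num_sides P) =
      root_of P ^ (k mod num_sides P)"
    by (simp only: power_add power_mult) simp
  then show ?thesis
    by (simp add: vertex_power)
qed

lemma vertex_in_vertices:
  assumes "nondegenerate P"
  shows "vertex P k \<in> vertices P"
proof -
  have "k mod num_sides P < num_sides P"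
    using assms by (simp add: nondegenerate_def)
  then show ?thesis
    unfolding vertices_def by (metis vertex_mod[OF assms] imageI lessThan_iff)
qed

lemma consecutive_in_sides:
  assumes "nondegenerate P"
  shows "{vertex P k, vertex P (Suc k)} \<in> sides P"
proof -
  have "k mod num_sides P < num_sides P"
    using assms by (simp add: nondegenerate_def)
  moreover have "vertex P (Suc (k mod num_sides P)) = vertex P (Suc k)"
    by (simp add: vertex_Suc vertex_mod[OF assms])
  ultimately show ?thesis
    unfolding sides_def mem_Collect_eq
    using vertex_mod[OF assms, of k] by (intro exI[of _ "k mod num_sides P"]) simp
qed

text \<open>An index that is a successor makes the clockwise neighbor \<open>vertex P k\<close>
  available for every corner, including corner 0.\<close>

lemma vertices_SucE:
  assumes "nondegenerate P" "v \<in> vertices P"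
  obtains k where "v = vertex P (Suc k)"
proof -
  obtain k where k: "v = vertex P k"
    using assms(2) by (auto simp: vertices_def)
  have "num_sides P > 0"
    using assms by (simp add: nondegenerate_def)
  then have "Suc (k + num_sides P - 1) mod num_sides P = k mod num_sides P"
    by simp
  then show ?thesis
    using that k vertex_mod[OF assms(1)] by metis
qed

lemma sides_at_vertex:
  assumes "nondegenerate P" "v \<in> vertices P"
  shows "{v, v + nxt P v} \<in> sides P" "{v, v + prv P v} \<in> sides P"
    "v + nxt P v \<in> vertices P" "v + prv P v \<in> vertices P"
proof -
  obtain k where k: "v = vertex P (Suc k)"
    using vertices_SucE[OF assms] .
  have "v + nxt P v = vertex P (Suc (Suc k))" "v + prv P v = vertex P k"
    using k vertex_Suc vertex_prv by metis+
  then show "{v, v + nxt P v} \<in> sides P" "{v, v + prv P v} \<in> sides P"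
    "v + nxt P v \<in> vertices P" "v + prv P v \<in> vertices P"
    using consecutive_in_sides[OF assms(1)] vertex_in_vertices[OF assms(1)] k
    by (simp_all only: insert_commute[of v]) (metis insert_commute)+
qed

lemma side_cases:
  assumes "nondegenerate P" "e \<in> sides P" "v \<in> e"
  shows "v \<in> vertices P" "e = {v, v + nxt P v} \<or> e = {v, v + prv P v}"
proof -
  obtain k where k: "e = {vertex P k, vertex P (Suc k)}"
    using assms(2) by (auto simp: sides_def)
  then have "v = vertex P k \<or> v = vertex P (Suc k)"
    using assms(3) by auto
  then show "v \<in> vertices P"
    using vertex_in_vertices[OF assms(1)] by auto
  from \<open>v = vertex P k \<or> v = vertex P (Suc k)\<close>
  show "e = {v, v + nxt P v} \<or> e = {v, v + prv P v}"
    using k vertex_Suc[of P k] vertex_prv[of P k] by (metis insert_commute)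
qed

lemma nxt_prv_nonzero:
  assumes "nondegenerate P" "v \<in> vertices P"
  shows "v \<noteq> center P" "nxt P v \<noteq> 0" "prv P v \<noteq> 0" "nxt P v \<noteq> prv P v"
proof -
  have n: "num_sides P \<ge> 3" "corner P \<noteq> center P"
    using assms by (auto simp: nondegenerate_def)
  \<comment> \<open>With at least three sides the root is not real, hence differs from 1 and from
    its conjugate.\<close>
  then have "sin (2 * pi / real (num_sides P)) > 0"
    by (intro sin_gt_zero) (auto simp: field_simps)
  then have r: "root_of P \<noteq> 1" "cnj (root_of P) \<noteq> 1" "root_of P \<noteq> cnj (root_of P)"
    by (auto simp: complex_eq_iff)
  show v: "v \<noteq> center P"
    using assms(2) n(2) by (auto simp: vertices_def vertex_power)
  show "nxt P v \<noteq> 0" "prv P v \<noteq> 0" "nxt P v \<noteq> prv P v"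
    using r v by (simp_all add: nxt_def prv_def)
qed

text \<open>The edges \<open>x0\<close>, \<open>x1\<close>, \<open>x2\<close> separate consecutive
  tiles, \<open>x2\<close> closing the cycle between \<open>P2\<close> and \<open>P0\<close>. The
  species yields only unordered pairs; which vector is \<open>nxt\<close> is decided by
  \<open>consistent_orientation\<close>.\<close>

lemma vertex_figure:
  assumes "\<forall>P\<in>T. nondegenerate P" "has_species T v [n0, n1, n2]"
  obtains P0 P1 P2 x0 x1 x2 where
    "{P \<in> T. v \<in> vertices P} = {P0, P1, P2}"
    "num_sides P0 = n0" "num_sides P1 = n1" "num_sides P2 = n2"
    "{e \<in> tiling_edges T. v \<in> e} = {{v, v + x0}, {v, v + x1}, {v, v + x2}}"
    "x0 \<noteq> x1" "x1 \<noteq> x2" "x2 \<noteq> x0"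
    "{nxt P0 v, prv P0 v} = {x2, x0}" "{nxt P1 v, prv P1 v} = {x0, x1}"
    "{nxt P2 v, prv P2 v} = {x1, x2}"
proof -
  obtain Ps es where *: "map num_sides Ps = [n0, n1, n2]" "length es = length Ps"
      "set Ps = {P \<in> T. v \<in> vertices P}" "distinct es" "set es = {e \<in> tiling_edges T. v \<in> e}"
      "\<And>i. i < length Ps \<Longrightarrow> es ! i \<in> sides (Ps ! i) \<inter> sides (Ps ! (Suc i mod length Ps))"
    using assms(2) unfolding has_species_def by metis
  obtain P0 P1 P2 where Ps: "Ps = [P0, P1, P2]" "num_sides P0 = n0" "num_sides P1 = n1" "num_sides P2 = n2"
    using *(1) by (auto simp: map_eq_Cons_conv)
  have "length es = Suc (Suc (Suc 0))"
    using *(2) Ps(1) by simp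
  then obtain e0 e1 e2 where es: "es = [e0, e1, e2]"
    by (auto simp: length_Suc_conv)
  have e: "e0 \<in> sides P0 \<inter> sides P1" "e1 \<in> sides P1 \<inter> sides P2" "e2 \<in> sides P2 \<inter> sides P0"
    using *(6)[of 0] *(6)[of 1] *(6)[of 2] Ps es by simp_all
  have v: "v \<in> e0" "v \<in> e1" "v \<in> e2"
    using *(5) es by auto
  have d: "e0 \<noteq> e1" "e1 \<noteq> e2" "e2 \<noteq> e0"
    using *(4) es by auto
  have nd: "nondegenerate P0" "nondegenerate P1" "nondegenerate P2"
    using *(3) Ps assms(1) by auto
  obtain x0 where x0: "e0 = {v, v + x0}"
    using side_cases(2)[OF nd(1) _ v(1)] e(1) by blast
  obtain x1 where x1: "e1 = {v, v + x1}"
    using side_cases(2)[OF nd(2) _ v(2)] e(2) by blast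
  obtain x2 where x2: "e2 = {v, v + x2}"
    using side_cases(2)[OF nd(3) _ v(3)] e(3) by blast
  have inj: "{v, v + x} = {v, v + y} \<longleftrightarrow> x = y" for x y
    by (auto simp: doubleton_eq_iff)
  \<comment> \<open>A polygon has just two sides at a corner, so two distinct ones are the
    \<open>nxt\<close> and the \<open>prv\<close> side in some order.\<close>
  have at: "{nxt P v, prv P v} = {x, y}"
    if "nondegenerate P" "{v, v + x} \<in> sides P" "{v, v + y} \<in> sides P" "{v, v + x} \<noteq> {v, v + y}" for P x y
    using side_cases(2)[OF that(1,2), of v] side_cases(2)[OF that(1,3), of v] that(4)
    by (auto simp: inj)
  show ?thesis
  proof (rule that)
    show "{P \<in> T. v \<in> vertices P} = {P0, P1, P2}"
      using *(3) Ps(1) by simp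
    show "{e \<in> tiling_edges T. v \<in> e} = {{v, v + x0}, {v, v + x1}, {v, v + x2}}"
      using *(5) es x0 x1 x2 by simp
    show "x0 \<noteq> x1" "x1 \<noteq> x2" "x2 \<noteq> x0"
      using d x0 x1 x2 by auto
    show "{nxt P0 v, prv P0 v} = {x2, x0}" "{nxt P1 v, prv P1 v} = {x0, x1}"
      "{nxt P2 v, prv P2 v} = {x1, x2}"
      using at[OF nd(1), of x2 x0] at[OF nd(2), of x0 x1] at[OF nd(3), of x1 x2] e d x0 x1 x2 by auto
  qed (fact Ps)+
qed

text \<open>Going around \<open>v\<close>, the three rotations multiply to 1. Under the side conditions this
  forces them to have the same sense, although interiors of tiles are never considered.\<close>

lemma consistent_orientation:
  assumes "{nxt P0 v, prv P0 v} = {x2, x0}" "{nxt P1 v, prv P1 v} = {x0, x1}"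
    "{nxt P2 v, prv P2 v} = {x1, x2}"
    and "x0 \<noteq> 0" "x1 \<noteq> 0" "x2 \<noteq> 0"
    and a: "a0 = turn (num_sides P0)" "a1 = turn (num_sides P1)" "a2 = turn (num_sides P2)"
    and ne: "a0 \<noteq> a1 * a2" "a1 \<noteq> a2 * a0" "a2 \<noteq> a0 * a1"
  shows "nxt P0 v = x2 \<and> prv P0 v = x0 \<and> nxt P1 v = x0 \<and> prv P1 v = x1 \<and> nxt P2 v = x1 \<and> prv P2 v = x2 \<or>
    nxt P0 v = x0 \<and> prv P0 v = x2 \<and> nxt P1 v = x1 \<and> prv P1 v = x0 \<and> nxt P2 v = x2 \<and> prv P2 v = x1"
proof -
  have p: "prv P0 v = nxt P0 v * a0" "prv P1 v = nxt P1 v * a1" "prv P2 v = nxt P2 v * a2"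
    using prv_eq_turn a by simp_all
  consider "nxt P0 v = x2" "prv P0 v = x0" | "nxt P0 v = x0" "prv P0 v = x2"
    using assms(1) by (auto simp: doubleton_eq_iff)
  moreover consider "nxt P1 v = x0" "prv P1 v = x1" | "nxt P1 v = x1" "prv P1 v = x0"
    using assms(2) by (auto simp: doubleton_eq_iff)
  moreover consider "nxt P2 v = x1" "prv P2 v = x2" | "nxt P2 v = x2" "prv P2 v = x1"
    using assms(3) by (auto simp: doubleton_eq_iff)
  \<comment> \<open>In a mixed pattern one tile runs against the other two, and its rotation would
    equal the product of theirs. The six inequalities rule out the six mixed patterns.\<close>
  moreover have "x0 * (a1 * a2) \<noteq> x0 * a0" "x1 * (a2 * a0) \<noteq> x1 * a1" "x2 * (a0 * a1) \<noteq> x2 * a2"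
    "x1 * (a0 * a1) \<noteq> x1 * a2" "x2 * (a1 * a2) \<noteq> x2 * a0" "x0 * (a2 * a0) \<noteq> x0 * a1"
    using ne assms(4-6) by simp_all
  ultimately show ?thesis
    using p by (smt (verit) mult.assoc mult.commute)
qed

lemma turn_3: "turn 3 = Complex (1 / 2) (sqrt 3 / 2)"
  and turn_4: "turn 4 = \<i>"
  and turn_6: "turn 6 = Complex (- 1 / 2) (sqrt 3 / 2)"
  and turn_12: "turn 12 = Complex (- sqrt 3 / 2) (1 / 2)"
  by (simp_all add: turn_def complex_eq_iff cos_120 sin_120 cos_60 sin_60 cos_30 sin_30)

section \<open>Corners of triangles and squares\<close>

lemma vertices_rotate:
  assumes "nondegenerate P"
  shows "vertices P = (\<lambda>j. vertex P (k + j)) ` {..<num_sides P}"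
proof
  let ?n = "num_sides P"
  have n: "?n > 0"
    using assms by (simp add: nondegenerate_def)
  show "(\<lambda>j. vertex P (k + j)) ` {..<?n} \<subseteq> vertices P"
    using vertex_in_vertices[OF assms] by auto
  show "vertices P \<subseteq> (\<lambda>j. vertex P (k + j)) ` {..<?n}"
  proof
    fix v assume "v \<in> vertices P"
    then obtain m where m: "v = vertex P m"
      by (auto simp: vertices_def)
    \<comment> \<open>\<open>j\<close> is \<open>m - k\<close> modulo the number of sides, written
      without subtraction.\<close>
    define j where "j = (m + (?n - 1) * k) mod ?n"
    have "(k + j) mod ?n = (k + (m + (?n - 1) * k)) mod ?n"
      by (simp add: j_def mod_add_right_eq)
    also have "k + (m + (?n - 1) * k) = m + ?n * k"
      using n by (cases ?n) (auto simp: algebra_simps)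
    finally have "vertex P (k + j) = v"
      using vertex_mod[OF assms] m by (metis mod_mult_self2)
    moreover have "j < ?n"
      using n by (simp add: j_def)
    ultimately show "v \<in> (\<lambda>j. vertex P (k + j)) ` {..<?n}"
      by auto
  qed
qed

lemma vertices_triangle:
  assumes "nondegenerate P" "num_sides P = 3" "v \<in> vertices P"
  shows "vertices P = {v, v + nxt P v, v + prv P v}"
proof -
  obtain k where k: "v = vertex P (Suc k)"
    using vertices_SucE[OF assms(1,3)] .
  have "{..<3::nat} = {0, 1, 2}"
    by auto
  then have "vertices P = {vertex P k, vertex P (Suc k), vertex P (Suc (Suc k))}"
    using vertices_rotate[OF assms(1), of k] assms(2) by simp
  then show ?thesis
    using vertex_Suc[of P "Suc k"] vertex_prv[of P k] k by auto
qed

lemma vertices_square: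
  fixes P v
  defines "s \<equiv> (\<lambda>u. u + nxt P u)"
  assumes "nondegenerate P" "num_sides P = 4" "v \<in> vertices P"
  shows "vertices P = {v, s v, s (s v), s (s (s v))}" "s (s (s (s v))) = v"
    "distinct [v, s v, s (s v), s (s (s v))]"
proof -
  obtain k where k: "v = vertex P (Suc k)"
    using vertices_SucE[OF assms(2,4)] .
  have s: "s (vertex P j) = vertex P (Suc j)" for j
    by (simp add: s_def vertex_Suc)
  have "{..<4::nat} = {0, 1, 2, 3}"
    by auto
  then show "vertices P = {v, s v, s (s v), s (s (s v))}"
    using vertices_rotate[OF assms(2), of "Suc k"] assms(3) k s by (simp add: eval_nat_numeral)
  \<comment> \<open>The successor map is a quarter turn about the center.\<close>
  have r: "root_of P = \<i>"
    using assms(3) by (simp add: complex_eq_iff)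
  have s_eq: "s u = center P + (u - center P) * \<i>" for u
    by (simp only: s_def nxt_def r) (simp add: algebra_simps)
  have s': "s v = center P + (v - center P) * \<i>" "s (s v) = center P - (v - center P)"
    "s (s (s v)) = center P - (v - center P) * \<i>" "s (s (s (s v))) = v"
    unfolding s_eq by (simp_all add: algebra_simps)
  show "s (s (s (s v))) = v"
    by (fact s')
  have "v - center P \<noteq> 0"
    using nxt_prv_nonzero(1)[OF assms(2,4)] by simp
  then show "distinct [v, s v, s (s v), s (s (s v))]"
    unfolding s'(3) unfolding s'(2) unfolding s'(1) by (auto simp: complex_eq_iff)
qed

section \<open>The two lattices\<close>

text \<open>Meaningful for sizes that occur exactly once in the species: the triangle in
  \<open>[3, 12, 12]\<close>, every tile in \<open>[4, 6, 12]\<close>.\<close>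

definition tile_of :: "rpolygon set \<Rightarrow> nat \<Rightarrow> complex \<Rightarrow> rpolygon" where
  "tile_of T n v = (THE P. P \<in> T \<and> v \<in> vertices P \<and> num_sides P = n)"

lemma nxt_eq_turn: "nxt P v = prv P v * cnj (turn (num_sides P))"
  by (simp add: prv_eq_turn mult.assoc turn_cnj)

text \<open>\<open>N\<close> is symmetric because labels belong to unordered edges. Nine consecutive
  colors have a spread of at most 8, and the extremes exist even for infinite \<open>W\<close>,
  whose image is finite.\<close>

lemma total_threshold_colorable_induced:
  fixes V :: "'a set"
  assumes "W \<subseteq> V"
    and ex: "\<And>N. (\<And>v w. N v w = N w v) \<Longrightarrow> \<exists>c. (\<forall>v\<in>V. c v \<in> {-4..4}) \<and>
      (\<forall>v\<in>V. \<forall>w\<in>V. {v, w} \<in> E \<longrightarrow> near (c v) (c w) = N v w)"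
  shows "total_threshold_colorable 9 2 (induced_subgraph (V, E) W)"
  unfolding total_threshold_colorable_def
proof
  fix l :: "'a set \<Rightarrow> edge_label"
  have "(l {v, w} = Near) = (l {w, v} = Near)" for v w
    by (simp add: insert_commute)
  from ex[of "\<lambda>v w. l {v, w} = Near", OF this] obtain c where c: "\<forall>v\<in>V. c v \<in> {-4..4}"
      "\<forall>v\<in>V. \<forall>w\<in>V. {v, w} \<in> E \<longrightarrow> near (c v) (c w) = (l {v, w} = Near)"
    by (elim exE conjE)
  have "threshold_coloring 2 (induced_subgraph (V, E) W) l c"
    using c(2) assms(1) by (auto simp: threshold_coloring_def induced_subgraph_def near_def)
  moreover have "has_range (induced_subgraph (V, E) W) c 9"
  proof (cases "W = {}")
    case False
    have sub: "c ` W \<subseteq> {-4..4}"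
      using c(1) assms(1) by (meson image_subsetI subsetD)
    then have fin: "finite (c ` W)"
      using finite_subset by blast
    have ne: "c ` W \<noteq> {}"
      using False by simp
    note in_image = Min_in[OF fin ne] Max_in[OF fin ne]
    then have "Min (c ` W) \<in> {-4..4}" "Max (c ` W) \<in> {-4..4}"
      using sub by (meson subsetD)+
    then have "Max (c ` W) - Min (c ` W) < 9"
      by simp
    then show ?thesis
      unfolding has_range_def induced_subgraph_def fst_conv
      by (intro disjI2 bexI[OF _ in_image(1)] bexI[OF _ in_image(2)]) (use fin in simp)
  qed (simp add: has_range_def induced_subgraph_def)
  ultimately show "\<exists>c. threshold_coloring 2 (induced_subgraph (V, E) W) l c \<and>
      has_range (induced_subgraph (V, E) W) c 9"
    by blast
qed

section \<open>The truncated hexagonal lattice\<close>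

lemma truncated_hexagonal_coloring:
  assumes nondegenerate: "\<forall>P\<in>T. nondegenerate P"
    and species: "\<And>v. v \<in> tiling_vertices T \<Longrightarrow> has_species T v [3, 12, 12]"
    and N: "\<And>v w. N v w = N w v"
  shows "\<exists>c. (\<forall>v\<in>tiling_vertices T. c v \<in> {-4..4}) \<and>
    (\<forall>v\<in>tiling_vertices T. \<forall>w\<in>tiling_vertices T. {v, w} \<in> tiling_edges T \<longrightarrow> near (c v) (c w) = N v w)"
proof -
  have nd: "nondegenerate P" if "P \<in> T" for P
    using nondegenerate that by blast
  let ?V = "tiling_vertices T" and ?E = "tiling_edges T"
  have sqrt3: "of_real (sqrt 3) * (of_real (sqrt 3) * z) = 3 * z" for z :: complex
    by (simp add: mult.assoc[symmetric] flip: of_real_mult)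
  define tile where "tile = tile_of T 3"
  \<comment> \<open>The outer edge continues the radius of the triangle and is as long as its side,
    which is \<open>sqrt 3\<close> times the circumradius.\<close>
  define D where "D v = of_real (sqrt 3) * (v - center (tile v))" for v
  have fig: "tile v \<in> T \<and> v \<in> vertices (tile v) \<and> num_sides (tile v) = 3 \<and>
      (\<forall>P\<in>T. v \<in> vertices P \<longrightarrow> num_sides P = 3 \<longrightarrow> P = tile v) \<and>
      {e \<in> ?E. v \<in> e} = {{v, v + nxt (tile v) v}, {v, v + prv (tile v) v}, {v, v + D v}}"
    if v: "v \<in> ?V" for v
  proof -
    obtain P0 P1 P2 x0 x1 x2 where P: "{P \<in> T. v \<in> vertices P} = {P0, P1, P2}"
        "num_sides P0 = 3" "num_sides P1 = 12" "num_sides P2 = 12"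
      and es: "{e \<in> ?E. v \<in> e} = {{v, v + x0}, {v, v + x1}, {v, v + x2}}"
      and x: "{nxt P0 v, prv P0 v} = {x2, x0}" "{nxt P1 v, prv P1 v} = {x0, x1}"
        "{nxt P2 v, prv P2 v} = {x1, x2}"
      using vertex_figure[OF nondegenerate species[OF v]] .
    have in_T: "P0 \<in> T" "P1 \<in> T" "P2 \<in> T" "v \<in> vertices P0" "v \<in> vertices P1" "v \<in> vertices P2"
      using P(1) by auto
    have uniq: "P = P0" if "P \<in> T" "v \<in> vertices P" "num_sides P = 3" for P
    proof -
      have "P \<in> {P0, P1, P2}"
        using that(1,2) P(1) by blast
      then show ?thesis
        using that(3) P(3,4) by auto
    qed
    have tile: "tile v = P0"
      unfolding tile_def tile_of_def by (rule the_equality) (use in_T P(2) uniq in blast)+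
    have nz: "x \<noteq> 0" if "x \<in> {nxt P v, prv P v}" "P \<in> T" "v \<in> vertices P" for x P
      using nxt_prv_nonzero(2,3)[OF nd[OF that(2)] that(3)] that(1) by auto
    have "x0 \<noteq> 0" "x1 \<noteq> 0" "x2 \<noteq> 0"
      using nz[of _ P0] nz[of _ P1] x in_T by simp_all
    then have "nxt P1 v = x0 \<and> prv P1 v = x1 \<and> nxt P2 v = x1 \<and> prv P2 v = x2 \<or>
        nxt P1 v = x1 \<and> prv P1 v = x0 \<and> nxt P2 v = x2 \<and> prv P2 v = x1"
      using consistent_orientation[OF x _ _ _ refl refl refl] P(2-4)
      by (auto simp: turn_3 turn_12 complex_eq_iff)
    \<comment> \<open>\<open>x1\<close> lies between the two 12-gons, so the triangle sides
      \<open>x0\<close> and \<open>x2\<close> are its rotations by 150 degrees in both senses.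
      Comparing their sum with the one given by the center of the triangle determines
      \<open>x1\<close>.\<close>
    then have "x0 = x1 * cnj (turn 12) \<and> x2 = x1 * turn 12 \<or> x0 = x1 * turn 12 \<and> x2 = x1 * cnj (turn 12)"
      using prv_eq_turn[of P1 v] prv_eq_turn[of P2 v] nxt_eq_turn[of P1 v] nxt_eq_turn[of P2 v] P(3,4)
      by metis
    then have "x0 + x2 = x1 * (turn 12 + cnj (turn 12))"
      by (auto simp: distrib_left)
    moreover have "turn 12 + cnj (turn 12) = - of_real (sqrt 3)"
      by (simp add: turn_12 complex_eq_iff)
    moreover have "x0 + x2 = - 3 * (v - center P0)"
    proof -
      have "x0 + x2 = nxt P0 v + prv P0 v"
        using x(1) by (auto simp: doubleton_eq_iff)
      then show ?thesis
        using nxt_add_prv[of P0 v] P(2) by (simp add: cos_120)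
    qed
    ultimately have "x1 * of_real (sqrt 3) = 3 * (v - center P0)"
      by (simp add: algebra_simps)
    then have "of_real (sqrt 3) * (of_real (sqrt 3) * x1) = of_real (sqrt 3) * (3 * (v - center P0))"
      by (simp only: mult.commute[of x1])
    then have "3 * x1 = 3 * (of_real (sqrt 3) * (v - center P0))"
      unfolding sqrt3 by (simp only: mult.left_commute)
    then have "x1 = D v"
      by (simp add: D_def tile)
    then have "{{v, v + x0}, {v, v + x1}, {v, v + x2}} =
        {{v, v + nxt P0 v}, {v, v + prv P0 v}, {v, v + D v}}"
      using x(1) by (auto simp: doubleton_eq_iff)
    then show ?thesis
      unfolding tile es using in_T(1,4) P(2) uniq by blast
  qed
  have in_V: "w \<in> ?V" if "P \<in> T" "w \<in> vertices P" for w P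
    using that by (auto simp: tiling_vertices_def)
  have tile: "tile v \<in> T" "v \<in> vertices (tile v)" "num_sides (tile v) = 3" if "v \<in> ?V" for v
    using fig[OF that] by blast+
  have tile_eq: "tile w = P" if "P \<in> T" "num_sides P = 3" "w \<in> vertices P" for w P
    using that fig[OF in_V[OF that(1,3)]] by blast
  have D_nz: "D v \<noteq> 0" if "v \<in> ?V" for v
    using nxt_prv_nonzero(1)[OF nd tile(2)] tile(1) that by (simp add: D_def)
  have edge: "v \<in> ?V \<and> v \<noteq> w \<and> (tile v = tile w \<or> w = v + D v)" if vw: "{v, w} \<in> ?E" for v w
  proof -
    obtain P where P: "P \<in> T" "{v, w} \<in> sides P"
      using vw by (auto simp: tiling_edges_def)
    have v: "v \<in> ?V"
      by (rule in_V[OF P(1)], rule side_cases(1)[OF nd[OF P(1)] P(2)]) simp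
    have "{v, w} \<in> {e \<in> ?E. v \<in> e}"
      using vw by simp
    then have cases: "{v, w} \<in> {{v, v + nxt (tile v) v}, {v, v + prv (tile v) v}, {v, v + D v}}"
      using fig[OF v] by simp
    have nz: "nxt (tile v) v \<noteq> 0" "prv (tile v) v \<noteq> 0"
      using nxt_prv_nonzero(2,3)[OF nd[OF tile(1)] tile(2), OF v v] .
    from cases have w: "w = v + nxt (tile v) v \<or> w = v + prv (tile v) v \<or> w = v + D v"
      by (auto simp: doubleton_eq_iff)
    moreover have "v + nxt (tile v) v \<in> vertices (tile v)" "v + prv (tile v) v \<in> vertices (tile v)"
      using sides_at_vertex(3,4)[OF nd[OF tile(1)] tile(2), OF v v] .
    ultimately have "tile w = tile v \<or> w = v + D v"
      using tile_eq[OF tile(1,3), OF v v] by blast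
    then show ?thesis
      using v w nz D_nz[OF v] by auto
  qed
  show ?thesis
  proof (rule direction_coloring[OF N, where D = D and tile = tile and ctr = center and pal = triangle_palette])
    fix v w assume vw: "{v, w} \<in> ?E"
    then have wv: "{w, v} \<in> ?E"
      by (simp add: insert_commute)
    have *: "D w = - D v \<and> (\<exists>k>0. center (tile w) - center (tile v) = of_real k * D v)"
      if "w = v + D v" "v = w + D w"
    proof
      have "v + (D v + D w) = v"
        using that by (simp only: add.assoc[symmetric])
      then show Dw: "D w = - D v"
        by (simp add: eq_neg_iff_add_eq_0 add.commute)
      define r :: complex where "r = of_real (1 / sqrt 3)"
      have "r * D u = u - center (tile u)" for u
        by (simp add: D_def r_def)
      then have ctr: "center (tile u) = u - r * D u" for u
        by simp
      have "of_real (1 + 2 / sqrt 3) = 1 + 2 * r"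
        by (simp add: r_def)
      \<comment> \<open>One edge plus a circumradius at each end, which is \<open>1 / sqrt 3\<close>
        times the edge.\<close>
      then have "center (tile w) - center (tile v) = of_real (1 + 2 / sqrt 3) * D v"
        unfolding ctr Dw by (subst that(1)) (simp add: algebra_simps)
      moreover have "(0::real) < 1 + 2 / sqrt 3"
        by (simp add: add_pos_pos)
      ultimately show "\<exists>k>0. center (tile w) - center (tile v) = of_real k * D v"
        by blast
    qed
    show "v \<in> ?V \<and> v \<noteq> w \<and> (tile v = tile w \<or> w = v + D v \<and> D w = - D v \<and>
        (\<exists>k>0. center (tile w) - center (tile v) = of_real k * D v))"
    proof (cases "tile v = tile w")
      case False
      then have "w = v + D v" "v = w + D w"
        using edge[OF vw] edge[OF wv] by auto
      with * edge[OF vw] show ?thesis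
        by blast
    qed (use edge[OF vw] in blast)
  next
    fix t :: rpolygon and x :: "complex \<Rightarrow> int" and lab :: "complex \<Rightarrow> bool"
    assume "t \<in> tile ` ?V" and x: "\<And>v. v \<in> ?V \<Longrightarrow> x v \<in> triangle_palette (line_class (D v))"
    then have t: "t \<in> T" "num_sides t = 3"
      using tile by blast+
    note ndt = nd[OF t(1)]
    have in_t: "v \<in> ?V \<and> tile v = t \<longleftrightarrow> v \<in> vertices t" for v
      using tile(2) tile_eq[OF t] in_V[OF t(1)] by blast
    have r: "root_of t = zeta6 - 1" "cnj (root_of t) = - zeta6"
      using t(2) by (simp_all add: complex_eq_iff cos_120 sin_120 cos_60 sin_60)
    have D_next: "D (v + nxt t v) = zeta6 * D v - D v" "D (v + prv t v) = - (zeta6 * D v)"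
      if "v \<in> vertices t" for v
    proof -
      have "tile v = t" "tile (v + nxt t v) = t" "tile (v + prv t v) = t"
        using tile_eq[OF t] sides_at_vertex(3,4)[OF ndt that] that by auto
      then show "D (v + nxt t v) = zeta6 * D v - D v" "D (v + prv t v) = - (zeta6 * D v)"
        unfolding D_def nxt_def prv_def r by (simp_all add: cnj_zeta6 algebra_simps)
    qed
    obtain v where v: "v \<in> vertices t"
      using vertex_in_vertices[OF ndt] by blast
    define odd where "odd u \<longleftrightarrow> positive_dir (D (u + nxt t u)) = positive_dir (D (u + prv t u)) \<and>
      positive_dir (D u) \<noteq> positive_dir (D (u + prv t u))" for u
    have "\<exists>u\<in>vertices t. odd u"
    proof -
      let ?v = "v + nxt t v" and ?w = "v + prv t v"
      have in_v: "?v \<in> vertices t" "?w \<in> vertices t"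
        using sides_at_vertex(3,4)[OF ndt v] by auto
      have eqs1: "?v + prv t ?v = v" "?w + nxt t ?w = v"
        by (simp_all add: prv_after_nxt nxt_after_prv)
      have eqs2: "?v + nxt t ?v = ?w" "?w + prv t ?w = ?v"
        unfolding nxt_def prv_def r by (simp_all add: cnj_zeta6 zeta6_times_zeta6 algebra_simps)
      \<comment> \<open>The three outer directions sum to zero, so their signs are not all equal,
        and one corner differs from the other two.\<close>
      have "positive_dir (D v) \<noteq> positive_dir (D ?v) \<or> positive_dir (D v) \<noteq> positive_dir (D ?w)"
      proof (rule ccontr)
        assume *: "\<not> ?thesis"
        have sum: "D v + D ?v = - D ?w" "- D v + - D ?v = D ?w"
          by (simp_all add: D_next[OF v])
        have nz: "D u \<noteq> 0" if "u \<in> vertices t" for u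
          using D_nz in_t that by blast
        show False
        proof (cases "positive_dir (D v)")
          case True
          then show False
            using * positive_dir_add[of "D v" "D ?v"] positive_dir_uminus[OF nz[OF in_v(2)]]
            unfolding sum by blast
        next
          case False
          then show False
            using * positive_dir_add[of "- D v" "- D ?v"] positive_dir_uminus[OF nz[OF v]]
              positive_dir_uminus[OF nz[OF in_v(1)]]
            unfolding sum by blast
        qed
      qed
      then have "odd v \<or> odd ?v \<or> odd ?w"
        unfolding odd_def eqs1 eqs2 by blast
      then show ?thesis
        using v in_v by blast
    qed
    then obtain u where u: "u \<in> vertices t" "odd u"
      by blast
    note vs = vertices_triangle[OF ndt t(2) u(1)]
    have "\<exists>c. (\<forall>y\<in>{u, u + nxt t u, u + prv t u}. c y \<in> {-4..4} \<and>
          (positive_dir (D y) \<longrightarrow> c y \<in> triangle_palette (line_class (D y))) \<and>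
          (\<not> positive_dir (D y) \<longrightarrow> near (c y) (x y) = lab y)) \<and>
        (\<forall>y\<in>{u, u + nxt t u, u + prv t u}. \<forall>z\<in>{u, u + nxt t u, u + prv t u}.
          y \<noteq> z \<longrightarrow> near (c y) (c z) = N y z)"
    proof (rule triangle_step[OF N])
      show "D u \<noteq> 0"
        using D_nz in_t u(1) by blast
      show "distinct [u, u + nxt t u, u + prv t u]"
        using nxt_prv_nonzero[OF ndt u(1)] by auto
      show "x y \<in> triangle_palette (line_class (D y))" if "y \<in> {u, u + nxt t u, u + prv t u}" for y
        using x in_t that vs by blast
    qed (use D_next[OF u(1)] u(2) in \<open>simp_all add: odd_def\<close>)
    then obtain c where
      c1: "\<And>y. y \<in> vertices t \<Longrightarrow> c y \<in> {-4..4} \<and>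
          (positive_dir (D y) \<longrightarrow> c y \<in> triangle_palette (line_class (D y))) \<and>
          (\<not> positive_dir (D y) \<longrightarrow> near (c y) (x y) = lab y)" and
      c2: "\<And>y z. y \<in> vertices t \<Longrightarrow> z \<in> vertices t \<Longrightarrow> y \<noteq> z \<Longrightarrow> near (c y) (c z) = N y z"
      unfolding vs[symmetric] by blast
    show "\<exists>c. (\<forall>v\<in>?V. tile v = t \<longrightarrow> c v \<in> {-4..4} \<and>
             (positive_dir (D v) \<longrightarrow> c v \<in> triangle_palette (line_class (D v))) \<and>
             (\<not> positive_dir (D v) \<longrightarrow> near (c v) (x v) = lab v)) \<and>
          (\<forall>v\<in>?V. \<forall>w\<in>?V. tile v = t \<longrightarrow> tile w = t \<longrightarrow> {v, w} \<in> ?E \<longrightarrow> near (c v) (c w) = N v w)"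
    proof (intro exI[of _ c] conjI[OF ballI ballI] ballI impI)
      fix v assume "v \<in> ?V" "tile v = t"
      then have "v \<in> vertices t"
        using in_t by blast
      then show "c v \<in> {-4..4} \<and> (positive_dir (D v) \<longrightarrow> c v \<in> triangle_palette (line_class (D v))) \<and>
          (\<not> positive_dir (D v) \<longrightarrow> near (c v) (x v) = lab v)"
        by (rule c1)
    next
      fix v w assume "v \<in> ?V" "w \<in> ?V" "tile v = t" "tile w = t" "{v, w} \<in> ?E"
      then show "near (c v) (c w) = N v w"
        using c2 in_t edge by blast
    qed
  next
    fix k show "triangle_palette k \<noteq> {} \<and> triangle_palette k \<subseteq> {-4..4}"
      by (intro conjI triangle_palette)
  qed (fact D_nz)
qed

section \<open>The truncated trihexagonal lattice\<close>

text \<open>Rotations by 300 and 240 degrees. Up to sign they relate the outer edges at the two ends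
  of a square side: from outer edge to side, and from side to outer edge, one turns by the interior
  angle of the 12-gon or hexagon beyond that side.\<close>

lemma turn_12_square: "x * turn 12 * turn 12 = x - zeta6 * x"
  and turn_6_square: "x * turn 6 * turn 6 = - (zeta6 * x)"
proof -
  have "turn 12 * turn 12 = 1 - zeta6" "turn 6 * turn 6 = - zeta6"
    by (simp_all add: turn_12 turn_6 zeta6_eq complex_eq_iff)
  then show "x * turn 12 * turn 12 = x - zeta6 * x" "x * turn 6 * turn 6 = - (zeta6 * x)"
    by (simp_all only: mult.assoc) (simp_all add: algebra_simps)
qed

lemma truncated_trihexagonal_coloring:
  assumes nondegenerate: "\<forall>P\<in>T. nondegenerate P"
    and species: "\<And>v. v \<in> tiling_vertices T \<Longrightarrow> has_species T v [4, 6, 12]"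
    and N: "\<And>v w. N v w = N w v"
  shows "\<exists>c. (\<forall>v\<in>tiling_vertices T. c v \<in> {-4..4}) \<and>
    (\<forall>v\<in>tiling_vertices T. \<forall>w\<in>tiling_vertices T. {v, w} \<in> tiling_edges T \<longrightarrow> near (c v) (c w) = N v w)"
proof -
  have nd: "nondegenerate P" if "P \<in> T" for P
    using nondegenerate that by blast
  let ?V = "tiling_vertices T" and ?E = "tiling_edges T"
  define Q H W where "Q = tile_of T 4" and "H = tile_of T 6" and "W = tile_of T 12"
  \<comment> \<open>\<open>pos v\<close> records the sense in which square, hexagon and 12-gon follow each other around \<open>v\<close>;
    it changes along every edge.\<close>
  define pos where "pos v \<longleftrightarrow> prv (H v) v = nxt (W v) v" for v
  \<comment> \<open>The outer edge is the side shared by the hexagon and the 12-gon.\<close>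
  define D where "D v = (if pos v then prv (H v) v else nxt (H v) v)" for v
  have fig: "(Q v \<in> T \<and> v \<in> vertices (Q v) \<and> num_sides (Q v) = 4) \<and>
      (H v \<in> T \<and> v \<in> vertices (H v) \<and> num_sides (H v) = 6) \<and>
      (W v \<in> T \<and> v \<in> vertices (W v) \<and> num_sides (W v) = 12) \<and>
      (\<forall>P\<in>T. v \<in> vertices P \<longrightarrow> P = Q v \<or> P = H v \<or> P = W v) \<and>
      {e \<in> ?E. v \<in> e} = {{v, v + nxt (Q v) v}, {v, v + prv (Q v) v}, {v, v + D v}} \<and>
      D v \<noteq> nxt (Q v) v \<and> D v \<noteq> prv (Q v) v \<and>
      (if pos v then nxt (H v) v = prv (Q v) v \<and> prv (H v) v = D v \<and>
         nxt (W v) v = D v \<and> prv (W v) v = nxt (Q v) v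
       else nxt (H v) v = D v \<and> prv (H v) v = nxt (Q v) v \<and>
         nxt (W v) v = prv (Q v) v \<and> prv (W v) v = D v)"
    if v: "v \<in> ?V" for v
  proof -
    obtain P0 P1 P2 x0 x1 x2 where P: "{P \<in> T. v \<in> vertices P} = {P0, P1, P2}"
        "num_sides P0 = 4" "num_sides P1 = 6" "num_sides P2 = 12"
      and es: "{e \<in> ?E. v \<in> e} = {{v, v + x0}, {v, v + x1}, {v, v + x2}}"
      and ne: "x0 \<noteq> x1" "x1 \<noteq> x2" "x2 \<noteq> x0"
      and x: "{nxt P0 v, prv P0 v} = {x2, x0}" "{nxt P1 v, prv P1 v} = {x0, x1}"
        "{nxt P2 v, prv P2 v} = {x1, x2}"
      using vertex_figure[OF nondegenerate species[OF v]] .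
    have in_T: "P0 \<in> T" "P1 \<in> T" "P2 \<in> T" "v \<in> vertices P0" "v \<in> vertices P1" "v \<in> vertices P2"
      using P(1) by auto
    have all: "P = P0 \<or> P = P1 \<or> P = P2" if "P \<in> T" "v \<in> vertices P" for P
    proof -
      have "P \<in> {P0, P1, P2}"
        using that P(1) by blast
      then show ?thesis
        by simp
    qed
    have tile: "Q v = P0" "H v = P1" "W v = P2"
      unfolding Q_def H_def W_def tile_of_def
    proof -
      show "(THE P. P \<in> T \<and> v \<in> vertices P \<and> num_sides P = 4) = P0"
        by (rule the_equality) (use in_T P(2-4) all in force)+
      show "(THE P. P \<in> T \<and> v \<in> vertices P \<and> num_sides P = 6) = P1"
        by (rule the_equality) (use in_T P(2-4) all in force)+
      show "(THE P. P \<in> T \<and> v \<in> vertices P \<and> num_sides P = 12) = P2"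
        by (rule the_equality) (use in_T P(2-4) all in force)+
    qed
    have nz: "x \<noteq> 0" if "x \<in> {nxt P v, prv P v}" "P \<in> T" "v \<in> vertices P" for x P
      using nxt_prv_nonzero(2,3)[OF nd[OF that(2)] that(3)] that(1) by auto
    have "x0 \<noteq> 0" "x1 \<noteq> 0" "x2 \<noteq> 0"
      using nz[of _ P0] nz[of _ P1] x in_T by simp_all
    then have "nxt P0 v = x2 \<and> prv P0 v = x0 \<and> nxt P1 v = x0 \<and> prv P1 v = x1 \<and> nxt P2 v = x1 \<and> prv P2 v = x2 \<or>
        nxt P0 v = x0 \<and> prv P0 v = x2 \<and> nxt P1 v = x1 \<and> prv P1 v = x0 \<and> nxt P2 v = x2 \<and> prv P2 v = x1"
      using consistent_orientation[OF x _ _ _ refl refl refl] P(2-4)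
      by (auto simp: turn_4 turn_6 turn_12 complex_eq_iff)
    then have "D v = x1 \<and> {nxt P0 v, prv P0 v} = {x0, x2} \<and>
      (if pos v then nxt P1 v = prv P0 v \<and> prv P1 v = D v \<and> nxt P2 v = D v \<and> prv P2 v = nxt P0 v
       else nxt P1 v = D v \<and> prv P1 v = nxt P0 v \<and> nxt P2 v = prv P0 v \<and> prv P2 v = D v)"
    proof (elim disjE conjE)
      assume *: "nxt P0 v = x2" "prv P0 v = x0" "nxt P1 v = x0" "prv P1 v = x1" "nxt P2 v = x1" "prv P2 v = x2"
      then have "pos v"
        by (simp add: pos_def tile)
      then show ?thesis
        using * by (simp add: D_def tile insert_commute)
    next
      assume *: "nxt P0 v = x0" "prv P0 v = x2" "nxt P1 v = x1" "prv P1 v = x0" "nxt P2 v = x2" "prv P2 v = x1"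
      then have "\<not> pos v"
        using ne by (simp add: pos_def tile)
      then show ?thesis
        using * by (simp add: D_def tile)
    qed
    moreover from this have "{{v, v + x0}, {v, v + x1}, {v, v + x2}} =
        {{v, v + nxt P0 v}, {v, v + prv P0 v}, {v, v + D v}}"
      by (auto simp: doubleton_eq_iff)
    moreover have "D v \<noteq> nxt P0 v \<and> D v \<noteq> prv P0 v"
      using calculation(1) ne by (auto simp: doubleton_eq_iff)
    ultimately show ?thesis
      unfolding tile es using in_T P(2-4) all by simp
  qed
  have in_V: "w \<in> ?V" if "P \<in> T" "w \<in> vertices P" for w P
    using that by (auto simp: tiling_vertices_def)
  have Q: "Q v \<in> T" "v \<in> vertices (Q v)" "num_sides (Q v) = 4" if "v \<in> ?V" for v
    using fig[OF that] by blast+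
  have H: "H v \<in> T" "v \<in> vertices (H v)" "num_sides (H v) = 6" if "v \<in> ?V" for v
    using fig[OF that] by blast+
  have W: "W v \<in> T" "v \<in> vertices (W v)" "num_sides (W v) = 12" if "v \<in> ?V" for v
    using fig[OF that] by blast+
  have D_ne: "D v \<noteq> nxt (Q v) v" "D v \<noteq> prv (Q v) v" if "v \<in> ?V" for v
    using fig[OF that] by blast+
  have pos: "nxt (H v) v = prv (Q v) v" "prv (H v) v = D v" "nxt (W v) v = D v" "prv (W v) v = nxt (Q v) v"
    if "v \<in> ?V" "pos v" for v
    using fig[OF that(1)] that(2) by simp_all
  have neg: "nxt (H v) v = D v" "prv (H v) v = nxt (Q v) v" "nxt (W v) v = prv (Q v) v" "prv (W v) v = D v"
    if "v \<in> ?V" "\<not> pos v" for v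
    using fig[OF that(1)] that(2) by simp_all
  have tile_eq: "num_sides P = 4 \<Longrightarrow> Q w = P" "num_sides P = 6 \<Longrightarrow> H w = P" "num_sides P = 12 \<Longrightarrow> W w = P"
    if "P \<in> T" "w \<in> vertices P" for w P
  proof -
    have "P = Q w \<or> P = H w \<or> P = W w"
      using fig[OF in_V[OF that]] that by blast
    then show "num_sides P = 4 \<Longrightarrow> Q w = P" "num_sides P = 6 \<Longrightarrow> H w = P" "num_sides P = 12 \<Longrightarrow> W w = P"
      using Q(3) H(3) W(3) in_V[OF that] by force+
  qed
  have D_nz: "D v \<noteq> 0" if v: "v \<in> ?V" for v
    unfolding D_def using nxt_prv_nonzero(2,3)[OF nd[OF H(1)] H(2), OF v v] by simp
  \<comment> \<open>The side from \<open>v\<close> to the next corner of the square borders the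
    12-gon if \<open>pos v\<close> and the hexagon otherwise. That polygon contains both ends and
    carries the outer direction from one to the other.\<close>
  have next_corner: "v + nxt (Q v) v \<in> ?V" "Q (v + nxt (Q v) v) = Q v"
      "pos (v + nxt (Q v) v) \<longleftrightarrow> \<not> pos v"
      "D (v + nxt (Q v) v) = (if pos v then zeta6 * D v - D v else zeta6 * D v)"
    if v: "v \<in> ?V" for v
  proof -
    define w where "w = v + nxt (Q v) v"
    have w_Q: "w \<in> vertices (Q v)"
      unfolding w_def using sides_at_vertex(3)[OF nd[OF Q(1)] Q(2), OF v v] .
    then have w: "w \<in> ?V" "Q w = Q v"
      using in_V[OF Q(1)[OF v]] tile_eq(1)[OF Q(1)[OF v]] Q(3)[OF v] by auto
    have prv_Q: "prv (Q w) w = - nxt (Q v) v"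
      unfolding w(2) by (simp add: w_def prv_after_nxt)
    have "(pos w \<longleftrightarrow> \<not> pos v) \<and> D w = (if pos v then zeta6 * D v - D v else zeta6 * D v)"
    proof (cases "pos v")
      case True
      have w_eq: "w = v + prv (W v) v"
        by (simp add: w_def pos(4)[OF v True])
      then have "w \<in> vertices (W v)"
        using sides_at_vertex(4)[OF nd[OF W(1)] W(2), OF v v] by simp
      then have Ww: "W w = W v"
        using tile_eq(3)[OF W(1)[OF v]] W(3)[OF v] by simp
      have nxt_W: "nxt (W w) w = - nxt (Q v) v"
        using nxt_after_prv[of "W v" v] w_eq pos(4)[OF v True] Ww by simp
      \<comment> \<open>Otherwise the vector back to \<open>v\<close> would be the outer edge at
        \<open>w\<close>, although it is a side of the square.\<close>
      have "\<not> pos w"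
        using pos(3)[OF w(1)] D_ne(2)[OF w(1)] prv_Q nxt_W by auto
      moreover from this have "D w = - nxt (Q v) v * turn 12"
        using neg(4)[OF w(1)] prv_eq_turn[of "W w" w] nxt_W W(3)[OF w(1)] by simp
      moreover have "nxt (Q v) v = D v * turn 12"
        using pos(3,4)[OF v True] prv_eq_turn[of "W v" v] W(3)[OF v] by simp
      ultimately show ?thesis
        using True turn_12_square[of "D v"] by simp
    next
      case False
      have w_eq: "w = v + prv (H v) v"
        by (simp add: w_def neg(2)[OF v False])
      then have "w \<in> vertices (H v)"
        using sides_at_vertex(4)[OF nd[OF H(1)] H(2), OF v v] by simp
      then have Hw: "H w = H v"
        using tile_eq(2)[OF H(1)[OF v]] H(3)[OF v] by simp
      have nxt_H: "nxt (H w) w = - nxt (Q v) v"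
        using nxt_after_prv[of "H v" v] w_eq neg(2)[OF v False] Hw by simp
      have "pos w"
        using neg(1)[OF w(1)] D_ne(2)[OF w(1)] prv_Q nxt_H by auto
      moreover from this have "D w = - nxt (Q v) v * turn 6"
        using pos(2)[OF w(1)] prv_eq_turn[of "H w" w] nxt_H H(3)[OF w(1)] by simp
      moreover have "nxt (Q v) v = D v * turn 6"
        using neg(1,2)[OF v False] prv_eq_turn[of "H v" v] H(3)[OF v] by simp
      ultimately show ?thesis
        using False turn_6_square[of "D v"] by simp
    qed
    then show "v + nxt (Q v) v \<in> ?V" "Q (v + nxt (Q v) v) = Q v"
      "pos (v + nxt (Q v) v) \<longleftrightarrow> \<not> pos v"
      "D (v + nxt (Q v) v) = (if pos v then zeta6 * D v - D v else zeta6 * D v)"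
      using w unfolding w_def by blast+
  qed
  \<comment> \<open>The outer edge is not radial for the square, so the radius vector of
    \<open>v\<close> is a complex multiple of \<open>D v\<close>. The factor is minus half the sum
    of the two square sides in units of \<open>D v\<close>; reversing the sense conjugates
    it.\<close>
  define m where "m = - (turn 12 + cnj (turn 6)) / 2"
  have center_eq: "center (Q v) = v - D v * (if pos v then m else cnj m)" if v: "v \<in> ?V" for v
  proof -
    have "nxt (Q v) v + prv (Q v) v = - 2 * (v - center (Q v))"
      using nxt_add_prv[of "Q v" v] Q(3)[OF v] by simp
    moreover have "nxt (Q v) v + prv (Q v) v = - 2 * (D v * (if pos v then m else cnj m))"
    proof (cases "pos v")
      case True
      then have "nxt (Q v) v = D v * turn 12" "prv (Q v) v = D v * cnj (turn 6)"
        using pos[OF v True] prv_eq_turn[of "W v" v] nxt_eq_turn[of "H v" v] W(3)[OF v] H(3)[OF v] by simp_all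
      with True show ?thesis
        by (simp add: m_def algebra_simps)
    next
      case False
      then have "nxt (Q v) v = D v * turn 6" "prv (Q v) v = D v * cnj (turn 12)"
        using neg[OF v False] prv_eq_turn[of "H v" v] nxt_eq_turn[of "W v" v] W(3)[OF v] H(3)[OF v] by simp_all
      with False show ?thesis
        by (simp add: m_def algebra_simps)
    qed
    ultimately have "v - center (Q v) = D v * (if pos v then m else cnj m)"
      by (metis mult_cancel_left neg_equal_0_iff_equal zero_neq_numeral)
    then show ?thesis
      by (simp add: algebra_simps)
  qed
  have edge: "v \<in> ?V \<and> v \<noteq> w \<and> (w = v + nxt (Q v) v \<or> w = v + prv (Q v) v \<or> w = v + D v)"
    if vw: "{v, w} \<in> ?E" for v w
  proof -
    obtain P where P: "P \<in> T" "{v, w} \<in> sides P"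
      using vw by (auto simp: tiling_edges_def)
    have v: "v \<in> ?V"
      by (rule in_V[OF P(1)], rule side_cases(1)[OF nd[OF P(1)] P(2)]) simp
    have "{v, w} \<in> {e \<in> ?E. v \<in> e}"
      using vw by simp
    then have cases: "{v, w} \<in> {{v, v + nxt (Q v) v}, {v, v + prv (Q v) v}, {v, v + D v}}"
      using fig[OF v] by simp
    have nz: "nxt (Q v) v \<noteq> 0" "prv (Q v) v \<noteq> 0"
      using nxt_prv_nonzero(2,3)[OF nd[OF Q(1)] Q(2), OF v v] .
    from cases have w: "w = v + nxt (Q v) v \<or> w = v + prv (Q v) v \<or> w = v + D v"
      by (auto simp: doubleton_eq_iff)
    then show ?thesis
      using v nz D_nz[OF v] by auto
  qed
  have prv_corner: "v + prv (Q v) v \<in> ?V" "Q (v + prv (Q v) v) = Q v" if v: "v \<in> ?V" for v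
    using sides_at_vertex(4)[OF nd[OF Q(1)] Q(2), OF v v] in_V[OF Q(1)[OF v]] tile_eq(1)[OF Q(1)[OF v]] Q(3)[OF v]
    by auto
  have outer: "D w = - D v \<and> (\<exists>k>0. center (Q w) - center (Q v) = of_real k * D v)"
    if vw: "{v, w} \<in> ?E" and w: "w = v + D v" for v w
  proof -
    have wv: "{w, v} \<in> ?E"
      using vw by (simp add: insert_commute)
    have V: "v \<in> ?V" "w \<in> ?V"
      using edge[OF vw] edge[OF wv] by blast+
    \<comment> \<open>If the way back were a side of the square, \<open>D v\<close> would be a side
      of it at \<open>v\<close>.\<close>
    have "v \<noteq> w + nxt (Q w) w"
    proof
      assume v: "v = w + nxt (Q w) w"
      have "prv (Q v) v = - nxt (Q w) w"
        unfolding v next_corner(2)[OF V(2)] by (rule prv_after_nxt)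
      also have "\<dots> = D v"
        using v w by (simp add: neg_eq_iff_add_eq_0 add.commute)
      finally show False
        using D_ne(2)[OF V(1)] by simp
    qed
    moreover have "v \<noteq> w + prv (Q w) w"
    proof
      assume v: "v = w + prv (Q w) w"
      have "nxt (Q v) v = - prv (Q w) w"
        unfolding v prv_corner(2)[OF V(2)] by (rule nxt_after_prv)
      also have "\<dots> = D v"
        using v w by (simp add: neg_eq_iff_add_eq_0 add.commute)
      finally show False
        using D_ne(1)[OF V(1)] by simp
    qed
    ultimately have "v = w + D w"
      using edge[OF wv] by blast
    then have "v + (D v + D w) = v"
      using w by (simp only: add.assoc[symmetric])
    then have Dw: "D w = - D v"
      by (simp add: eq_neg_iff_add_eq_0 add.commute)
    \<comment> \<open>The hexagon contains both ends, and a \<open>prv\<close> side seen from its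
      other end is the \<open>nxt\<close> side, and conversely.\<close>
    have flip: "pos w \<longleftrightarrow> \<not> pos v"
    proof (cases "pos v")
      case True
      have w_eq: "w = v + prv (H v) v"
        by (simp add: w pos(2)[OF V(1) True])
      then have "w \<in> vertices (H v)"
        using sides_at_vertex(4)[OF nd[OF H(1)] H(2), OF V(1) V(1)] by simp
      then have Hw: "H w = H v"
        using tile_eq(2)[OF H(1)[OF V(1)]] H(3)[OF V(1)] by simp
      have "nxt (H w) w = D w"
        using nxt_after_prv[of "H v" v] w_eq pos(2)[OF V(1) True] Hw Dw by simp
      then show ?thesis
        using True pos(2)[OF V(2)] nxt_prv_nonzero(4)[OF nd[OF H(1)] H(2), OF V(2) V(2)] by auto
    next
      case False
      have w_eq: "w = v + nxt (H v) v"
        by (simp add: w neg(1)[OF V(1) False])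
      then have "w \<in> vertices (H v)"
        using sides_at_vertex(3)[OF nd[OF H(1)] H(2), OF V(1) V(1)] by simp
      then have Hw: "H w = H v"
        using tile_eq(2)[OF H(1)[OF V(1)]] H(3)[OF V(1)] by simp
      have "prv (H w) w = D w"
        using prv_after_nxt[of "H v" v] w_eq neg(1)[OF V(1) False] Hw Dw by simp
      then show ?thesis
        using False neg(1)[OF V(2)] nxt_prv_nonzero(4)[OF nd[OF H(1)] H(2), OF V(2) V(2)] by auto
    qed
    have m: "m + cnj m = of_real ((1 + sqrt 3) / 2)"
      by (simp add: m_def turn_12 turn_6 complex_eq_iff field_simps)
    \<comment> \<open>As \<open>pos\<close> flips, the ends contribute \<open>m\<close> and its
      conjugate, so the imaginary parts cancel and the centers differ by a real multiple of
      \<open>D v\<close>.\<close>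
    have "center (Q w) - center (Q v) = D v * (1 + (m + cnj m))"
      unfolding center_eq[OF V(1)] center_eq[OF V(2)] Dw
      by (subst w) (simp add: flip algebra_simps)
    also have "\<dots> = of_real (1 + (1 + sqrt 3) / 2) * D v"
      unfolding m by (simp add: mult.commute)
    finally have "center (Q w) - center (Q v) = of_real (1 + (1 + sqrt 3) / 2) * D v" .
    moreover have "(0::real) < 1 + (1 + sqrt 3) / 2"
      by (simp add: add_pos_nonneg)
    ultimately show ?thesis
      using Dw by blast
  qed
  show ?thesis
  proof (rule direction_coloring[OF N, where D = D and tile = Q and ctr = center and pal = square_palette])
    fix v w assume vw: "{v, w} \<in> ?E"
    have v: "v \<in> ?V" "v \<noteq> w"
      using edge[OF vw] by blast+
    show "v \<in> ?V \<and> v \<noteq> w \<and> (Q v = Q w \<or> w = v + D v \<and> D w = - D v \<and>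
        (\<exists>k>0. center (Q w) - center (Q v) = of_real k * D v))"
    proof (cases "w = v + D v")
      case True
      then show ?thesis
        using v outer[OF vw] by blast
    next
      case False
      then have "Q w = Q v"
        using edge[OF vw] next_corner(2)[OF v(1)] prv_corner(2)[OF v(1)] by blast
      then show ?thesis
        using v by simp
    qed
  next
    fix t :: rpolygon and x :: "complex \<Rightarrow> int" and lab :: "complex \<Rightarrow> bool"
    assume "t \<in> Q ` ?V" and x: "\<And>v. v \<in> ?V \<Longrightarrow> x v \<in> square_palette (line_class (D v))"
    then have t: "t \<in> T" "num_sides t = 4"
      using Q by blast+
    note ndt = nd[OF t(1)]
    have in_t: "v \<in> ?V \<and> Q v = t \<longleftrightarrow> v \<in> vertices t" for v
      using Q(2) tile_eq(1)[OF t(1) _ t(2)] in_V[OF t(1)] by blast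
    define s where "s v = v + nxt t v" for v
    have s: "s v \<in> vertices t" "pos (s v) \<longleftrightarrow> \<not> pos v"
        "D (s v) = (if pos v then zeta6 * D v - D v else zeta6 * D v)" if "v \<in> vertices t" for v
    proof -
      have v: "v \<in> ?V" "Q v = t"
        using in_t that by blast+
      show "s v \<in> vertices t"
        unfolding s_def using sides_at_vertex(3)[OF ndt that] .
      show "pos (s v) \<longleftrightarrow> \<not> pos v" "D (s v) = (if pos v then zeta6 * D v - D v else zeta6 * D v)"
        using next_corner(3,4)[OF v(1)] unfolding v(2) s_def by blast+
    qed
    \<comment> \<open>Two steps around the square multiply by \<open>zeta6\<close> and
      \<open>zeta6\<^sup>2\<close> in some order, and \<open>zeta6 ^ 3\<close> is -1.\<close>
    have opposite: "D (s (s v)) = - D v" if "v \<in> vertices t" for v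
      using s(2,3)[OF that] s(3)[OF s(1)[OF that]] zeta6_mult(3)[of "D v"]
      by (simp add: right_diff_distrib split: if_splits)
    obtain v where v: "v \<in> vertices t"
      using vertex_in_vertices[OF ndt] by blast
    have nz: "D u \<noteq> 0" if "u \<in> vertices t" for u
      using D_nz in_t that by blast
    note square = vertices_square[OF ndt t(2), folded s_def]
    \<comment> \<open>Opposite corners have opposite signs, so two consecutive corners are both
      negative; the four cases locate the first of them.\<close>
    have "\<exists>u\<in>vertices t. \<not> positive_dir (D u) \<and> \<not> positive_dir (D (s u))"
    proof -
      note corners = s(1)[OF v] s(1)[OF s(1)[OF v]] s(1)[OF s(1)[OF s(1)[OF v]]]
      note dirs = opposite[OF v] opposite[OF corners(1)] square(2)[OF v]
        positive_dir_uminus[OF nz[OF v]] positive_dir_uminus[OF nz[OF corners(1)]]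
      show ?thesis
      proof (cases "positive_dir (D v)")
        case True
        then show ?thesis
        proof (cases "positive_dir (D (s v))")
          case True
          then show ?thesis
            using \<open>positive_dir (D v)\<close> dirs by (intro bexI[OF _ corners(2)]) simp
        next
          case False
          then show ?thesis
            using \<open>positive_dir (D v)\<close> dirs by (intro bexI[OF _ corners(1)]) simp
        qed
      next
        case False
        then show ?thesis
        proof (cases "positive_dir (D (s v))")
          case True
          then show ?thesis
            using \<open>\<not> positive_dir (D v)\<close> dirs by (intro bexI[OF _ corners(3)]) simp
        next
          case False
          then show ?thesis
            using \<open>\<not> positive_dir (D v)\<close> by (intro bexI[OF _ v]) simp
        qed
      qed
    qed
    then obtain u where u: "u \<in> vertices t" "\<not> positive_dir (D u)" "\<not> positive_dir (D (s u))"
      by blast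
    note vs = square(1)[OF u(1)]
    have "\<exists>c. (\<forall>y\<in>{u, s u, s (s u), s (s (s u))}. c y \<in> {-4..4} \<and>
          (positive_dir (D y) \<longrightarrow> c y \<in> square_palette (line_class (D y))) \<and>
          (\<not> positive_dir (D y) \<longrightarrow> near (c y) (x y) = lab y)) \<and>
        (\<forall>y z. {y, z} \<in> {{u, s u}, {s u, s (s u)}, {s (s u), s (s (s u))}, {s (s (s u)), u}} \<longrightarrow>
          near (c y) (c z) = N y z)"
    proof (rule square_step[OF N])
      show "D u \<noteq> 0" "D (s u) \<noteq> 0"
        using nz u(1) s(1) by blast+
      show "D (s (s u)) = - D u" "D (s (s (s u))) = - D (s u)"
        using opposite u(1) s(1) by blast+
      show "line_class (D u) \<noteq> line_class (D (s u))"
      proof (cases "pos u")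
        case True
        have nz': "D (s u) \<noteq> 0"
          using nz u(1) s(1) by blast
        \<comment> \<open>Here the direction turns by 120 degrees, so \<open>- D u\<close> is a
          single step of 60 degrees from \<open>D (s u)\<close>, and the class ignores the
          sign.\<close>
        have "D (s u) = zeta6 * (zeta6 * D u)"
          using s(3)[OF u(1)] True zeta6_mult(3) by simp
        moreover have "zeta6 * D (s u) = - D u"
          using s(3)[OF u(1)] True zeta6_mult(3) by (simp add: right_diff_distrib)
        ultimately show ?thesis
          using line_class_zeta6[OF nz'] line_class_uminus[OF nz[OF u(1)]] by simp
      next
        case False
        then show ?thesis
          using s(3)[OF u(1)] line_class_zeta6[OF nz[OF u(1)]] by simp
      qed
      show "distinct [u, s u, s (s u), s (s (s u))]"
        by (rule square(3)[OF u(1)])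
      show "x y \<in> square_palette (line_class (D y))" if "y \<in> {u, s u, s (s u), s (s (s u))}" for y
        using x in_t that vs by blast
    qed (use u in simp_all)
    then obtain c where
      c1: "\<And>y. y \<in> vertices t \<Longrightarrow> c y \<in> {-4..4} \<and>
          (positive_dir (D y) \<longrightarrow> c y \<in> square_palette (line_class (D y))) \<and>
          (\<not> positive_dir (D y) \<longrightarrow> near (c y) (x y) = lab y)" and
      c2: "\<And>y z. {y, z} \<in> {{u, s u}, {s u, s (s u)}, {s (s u), s (s (s u))}, {s (s (s u)), u}} \<Longrightarrow>
          near (c y) (c z) = N y z"
      unfolding vs[symmetric] by blast
    have c3: "near (c y) (c (s y)) = N y (s y)" if "y \<in> vertices t" for y
    proof (rule c2)
      show "{y, s y} \<in> {{u, s u}, {s u, s (s u)}, {s (s u), s (s (s u))}, {s (s (s u)), u}}"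
        using that square(2)[OF u(1)] unfolding vs by (elim insertE) simp_all
    qed
    show "\<exists>c. (\<forall>v\<in>?V. Q v = t \<longrightarrow> c v \<in> {-4..4} \<and>
             (positive_dir (D v) \<longrightarrow> c v \<in> square_palette (line_class (D v))) \<and>
             (\<not> positive_dir (D v) \<longrightarrow> near (c v) (x v) = lab v)) \<and>
          (\<forall>v\<in>?V. \<forall>w\<in>?V. Q v = t \<longrightarrow> Q w = t \<longrightarrow> {v, w} \<in> ?E \<longrightarrow> near (c v) (c w) = N v w)"
    proof (intro exI[of _ c] conjI[OF ballI ballI] ballI impI)
      fix v assume "v \<in> ?V" "Q v = t"
      then have "v \<in> vertices t"
        using in_t by blast
      then show "c v \<in> {-4..4} \<and> (positive_dir (D v) \<longrightarrow> c v \<in> square_palette (line_class (D v))) \<and>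
          (\<not> positive_dir (D v) \<longrightarrow> near (c v) (x v) = lab v)"
        by (rule c1)
    next
      fix v w assume v: "v \<in> ?V" "Q v = t" and w: "w \<in> ?V" "Q w = t" and vw: "{v, w} \<in> ?E"
      \<comment> \<open>An outer edge joins tiles with distinct centers, so none runs inside a
        tile.\<close>
      have "w \<noteq> v + D v"
      proof
        assume "w = v + D v"
        then obtain k where k: "k > 0" "center (Q w) - center (Q v) = of_real k * D v"
          using outer[OF vw] by blast
        then show False
          using v w D_nz[OF v(1)] by simp
      qed
      then consider "w = s v" | "w = v + prv t v"
        using edge[OF vw] v(2) unfolding s_def by blast
      then show "near (c v) (c w) = N v w"
      proof cases
        case 1
        then show ?thesis
          using c3 in_t v by blast
      next
        case 2
        then have "v = s w"
          by (simp add: s_def nxt_after_prv)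
        moreover have "w \<in> vertices t"
          using in_t w by blast
        ultimately have "near (c w) (c v) = N w v"
          using c3 by blast
        then show ?thesis
          using near_commute N by simp
      qed
    qed
  next
    fix k show "square_palette k \<noteq> {} \<and> square_palette k \<subseteq> {-4..4}"
      by (intro conjI square_palette)
  qed (fact D_nz)
qed

theorem mainTheorem4:
  "(\<forall>G. archimedean_lattice [3, 12, 12] G \<longrightarrow>
      (\<forall>W \<subseteq> fst G. total_threshold_colorable 9 2 (induced_subgraph G W))) \<and>
   (\<forall>G. archimedean_lattice [4, 6, 12] G \<longrightarrow>
      (\<forall>W \<subseteq> fst G. total_threshold_colorable 9 2 (induced_subgraph G W)))"
proof (intro conjI allI impI)
  fix G W assume G: "archimedean_lattice [3, 12, 12] G" and W: "W \<subseteq> fst G"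
  then obtain T where T: "\<forall>P\<in>T. nondegenerate P" "\<And>v. v \<in> tiling_vertices T \<Longrightarrow> has_species T v [3, 12, 12]"
      "G = (tiling_vertices T, tiling_edges T)"
    by (auto simp: archimedean_lattice_def edge_to_edge_tiling_def tiling_graph_def)
  show "total_threshold_colorable 9 2 (induced_subgraph G W)"
    unfolding T(3) using W T(3) truncated_hexagonal_coloring[OF T(1,2)]
    by (intro total_threshold_colorable_induced) simp_all
next
  fix G W assume G: "archimedean_lattice [4, 6, 12] G" and W: "W \<subseteq> fst G"
  then obtain T where T: "\<forall>P\<in>T. nondegenerate P" "\<And>v. v \<in> tiling_vertices T \<Longrightarrow> has_species T v [4, 6, 12]"
      "G = (tiling_vertices T, tiling_edges T)"
    by (auto simp: archimedean_lattice_def edge_to_edge_tiling_def tiling_graph_def)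
  show "total_threshold_colorable 9 2 (induced_subgraph G W)"
    unfolding T(3) using W T(3) truncated_trihexagonal_coloring[OF T(1,2)]
    by (intro total_threshold_colorable_induced) simp_all
qed
end
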